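(* Let $P_0(t),H_0(t)\in\mathbb{R}$, $\mu_1,\Delta P(t),\Delta H(t)\ge0$ and $\delta_{P,t},\delta_{H,t}>0$ for $t=1,\dots,T$, and let $\mathcal{W}\subset\mathbb{R}^{2T}$ be the set of all $(P(t),H(t))_{t=1}^T$ of the form $$P(t)=P_0(t)+\eta^P_1(t)+\eta^P_\infty(t),\qquad H(t)=H_0(t)+\eta^H_1(t)+\eta^H_\infty(t),$$ $$\sum_{t=1}^T\big[|\delta_{P,t}\eta^P_1(t)|+|\delta_{H,t}\eta^H_1(t)|\big]\le\mu_1,\qquad |\eta^P_\infty(t)|\le\Delta P(t),\quad |\eta^H_\infty(t)|\le\Delta H(t)\quad\forall t.$$ Take any $\epsilon>0$ and run Algorithm A (described in the context) with $${\rm Thresh}=\Big\{\min_{e\in\mathcal{E}}W_{\rm spike}(e),\ \min_{e\in\mathcal{E}}W_{\rm spike}(e)+\epsilon,\ \min_{e\in\mathcal{E}}W_{\rm spike}(e)+2\epsilon,\ \dots,\ \max_{e\in\mathcal{E}}W_{\rm spike}(e)\Big\}.$$ Let $V^{\star,\epsilon}$ be the value provided by this algorithm, and let $$V^\star=\min_{p\in\mathrm{PATH}_{s\to q}(\mathcal{G})}\ \max_{\xi\in\mathcal{W}}\ \sum_{e\in p}w_e(\xi)$$ be the optimal value of the robust shortest-path problem with uncertainty set $\mathcal{W}$. Then $V^\star\le V^{\star,\epsilon}\le V^\star+\epsilon$. Moreover, the computational complexity of the algorithm is $$O\left(|\mathcal{E}|\cdot\left\lceil\frac{\max_{e\in\mathcal{E}}W_{\rm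 spike}(e)-\min_{e\in\mathcal{E}}W_{\rm spike}(e)}{\epsilon}\right\rceil\right).$$
   Context: Turbine model: $\mathcal{X}$ is a finite set of states; for each $x\in\mathcal{X}$, $\mathcal{U}(x)$ is the set of admissible controls at $x$; applying $u\in\mathcal{U}(x)$ at $x$ leads to the state $f(x,u)\in\mathcal{X}$ after $c(x,u)\in\{1,2,\dots\}$ time steps. $C_{\rm MGT}(x,u)$ is the operating cost of this transition, and $P_{\rm MGT}(x,u),H_{\rm MGT}(x,u)$ are the power and heat generated per time step. $T\in\mathbb{N}$ is the horizon. For each $t\in\{1,\dots,T\}$, $C^P_{U,t},C^H_{U,t}:\mathbb{R}\to\mathbb{R}\cup\{+\infty\}$ are the costs of purchasing power and heat from a utility (negative arguments mean selling power or exhausting heat; an infinite cost models inability to sell power); each is convex and is non-decreasing on the set where it is finite, and $C^H_{U,t}(x)=0$ for $x<0$. A demand profile is $\xi=(P(t),H(t))_{t=1}^T\in\mathbb{R}^{2T}$. Graph: $\mathcal{G}=(\mathcal{V},\mathcal{E})$ is the finite directed acyclic graph whose vertices are the pairs $(t,x)$, $t\in\{1,\dots,T\}$, $x\in\mathcal{X}$, together with a source $s$ and a terminal $q$. There is a transition edge $e=(t_1,x_1)\to(t_2,x_2)$ whenever there is some $u_1\in\mathcal{U}(x_1)$ with $f(x_1,u_1)=x_2$ and $t_2=t_1+c(x_1,u_1)$; its cost is $$w_e(\xi)=C_{\rm MGT}(x_1,u_1)+\sum_{t=t_1}^{t_2-1}\big[C^P_{U,t}(P(t)-P_{\rm MGT}(x_1,u_1))+C^H_{U,t}(H(t)-H_{\rm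 MGT}(x_1,u_1))\big].$$ For every $x\in\mathcal{X}$ there are also edges $s\to(1,x)$ and $(T,x)\to q$ of cost zero. $\mathrm{PATH}_{s\to q}(\mathcal{G})$ is the set of directed paths from $s$ to $q$. Let $\bar P_0(t)=P_0(t)+\Delta P(t)$, $\bar H_0(t)=H_0(t)+\Delta H(t)$, and for $i=1,\dots,T$ let $\Delta P^{(i)}(t)=\frac{\mu_1}{\delta_{P,t}}\mathbf{1}_{\{i=t\}}$, $\Delta H^{(i)}(t)=\frac{\mu_1}{\delta_{H,t}}\mathbf{1}_{\{i=t\}}$. For a transition edge $e$ from time $t_1$ to time $t_2$, define $W_{\rm bias}(e)=w_e\big((\bar P_0(t),\bar H_0(t))_{t=1}^T\big)$ and $$W_{\rm spike}(e)=\max_{t_1\le k<t_2}\max\Big\{w_e\big((\bar P_0(t)+\Delta P^{(k)}(t),\bar H_0(t))_{t=1}^T\big),\ w_e\big((\bar P_0(t),\bar H_0(t)+\Delta H^{(k)}(t))_{t=1}^T\big)\Big\}-W_{\rm bias}(e).$$ The zero-cost edges at $s$ and $q$ have $W_{\rm bias}=0$; maxima and minima of $W_{\rm spike}$ range over transition edges only. For $\alpha\in\mathbb{R}$, $\mathcal{G}_\alpha$ is the graph $(\mathcal{V},\mathcal{E})$ with weights $\omega_\alpha(e)=W_{\rm bias}(e)$ if $W_{\rm spike}(e)\le\alpha$ and $\omega_\alpha(e)=\infty$ if $W_{\rm spike}(e)>\alpha$ (the edges at $s$ and $q$ keep weight zero). Algorithm A with a given finite threshold set ${\rm Thresh}$: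 (1) Compute $W_{\rm bias}(e)$ and $W_{\rm spike}(e)$ for each edge $e$. (2) For each $\alpha\in{\rm Thresh}$, solve the shortest-path problem from $s$ to $q$ in $\mathcal{G}_\alpha$, in case of a tie favoring the path with the lower maximal $W_{\rm spike}$; let $V_{\rm path}(\alpha)$ be the optimal path and set $V_{\rm cost}(\alpha)=\sum_{e\in V_{\rm path}(\alpha)}W_{\rm bias}(e)+\max_{e\in V_{\rm path}(\alpha)}W_{\rm spike}(e)$. (3) Find $\gamma\in\arg\min_{\beta\in{\rm Thresh}}V_{\rm cost}(\beta)$ and return the value $V_{\rm cost}(\gamma)$ and the path $V_{\rm path}(\gamma)$.
   Formalization: Added: edges with finite W_spike have finite cost on all of W (false otherwise); Thresh uses finite W_spike, assumed to exist, as does an s-q path; ceiling is at least 1; edges come in topological order; O-constant is absolute for unit-time edge weights, else depends on the longest transition. *)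

theory Defs
  imports
    Complex_Main
    "HOL-Library.Extended_Real"
    "HOL-Library.Monad_Syntax"
    "Graph_Theory.Arc_Walk"
begin

section \<open>Turbine model and demand\<close>

text \<open>
  A demand profile in the \<open>2 T\<close>-dimensional real space is a pair \<open>(P, H)\<close> of functions of time
  of which only the values at \<open>1, \<dots>, T\<close> are ever used; likewise for all other
  time-indexed data.
\<close>

type_synonym demand = "(nat \<Rightarrow> real) \<times> (nat \<Rightarrow> real)"

record ('x, 'u) mgt =
  states :: "'x set"
  controls :: "'x \<Rightarrow> 'u set"
  succ_state :: "'x \<Rightarrow> 'u \<Rightarrow> 'x"       \<comment> \<open>\<open>f(x,u)\<close>\<close>
  dur :: "'x \<Rightarrow> 'u \<Rightarrow> nat"             \<comment> \<open>\<open>c(x,u)\<close>\<close>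
  op_cost :: "'x \<Rightarrow> 'u \<Rightarrow> real"
  gen_P :: "'x \<Rightarrow> 'u \<Rightarrow> real"
  gen_H :: "'x \<Rightarrow> 'u \<Rightarrow> real"
  horizon :: nat
  util_P :: "nat \<Rightarrow> real \<Rightarrow> ereal"
  util_H :: "nat \<Rightarrow> real \<Rightarrow> ereal"
  nom_P :: "nat \<Rightarrow> real"               \<comment> \<open>\<open>P\<^sub>0\<close>\<close>
  nom_H :: "nat \<Rightarrow> real"               \<comment> \<open>\<open>H\<^sub>0\<close>\<close>
  dev_P :: "nat \<Rightarrow> real"               \<comment> \<open>\<open>\<Delta>P\<close>\<close>
  dev_H :: "nat \<Rightarrow> real"               \<comment> \<open>\<open>\<Delta>H\<close>\<close>
  wgt_P :: "nat \<Rightarrow> real"               \<comment> \<open>\<open>\<delta>\<^sub>P\<close>\<close>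
  wgt_H :: "nat \<Rightarrow> real"               \<comment> \<open>\<open>\<delta>\<^sub>H\<close>\<close>
  budget :: real                      \<comment> \<open>\<open>\<mu>\<^sub>1\<close>\<close>

definition ereal_convex :: "(real \<Rightarrow> ereal) \<Rightarrow> bool" where
  "ereal_convex C \<longleftrightarrow> (\<forall>x y \<theta>. 0 < \<theta> \<and> \<theta> < 1 \<longrightarrow>
     C ((1 - \<theta>) * x + \<theta> * y) \<le> ereal (1 - \<theta>) * C x + ereal \<theta> * C y)"

definition utility_cost :: "(real \<Rightarrow> ereal) \<Rightarrow> bool" where
  "utility_cost C \<longleftrightarrow> (\<forall>x. C x \<noteq> -\<infinity>) \<and> ereal_convex C \<and>
     (\<forall>x y. x \<le> y \<and> C x < \<infinity> \<and> C y < \<infinity> \<longrightarrow> C x \<le> C y)"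

section \<open>The transition graph\<close>

text \<open>
  Edges carry the control that produces them, so two controls leading from \<open>(t\<^sub>1,x\<^sub>1)\<close> to the same
  \<open>(t\<^sub>2,x\<^sub>2)\<close> give parallel edges, each with its own well-defined cost.
\<close>

datatype 'x vertex = Source | Node nat 'x | Terminal

datatype ('x, 'u) edge = SrcE 'x | is_Trans: Trans nat 'x 'u | SinkE 'x

fun edge_tail :: "('x, 'u) mgt \<Rightarrow> ('x, 'u) edge \<Rightarrow> 'x vertex" where
  "edge_tail I (SrcE x) = Source"
| "edge_tail I (Trans t x u) = Node t x"
| "edge_tail I (SinkE x) = Node (horizon I) x"

fun edge_head :: "('x, 'u) mgt \<Rightarrow> ('x, 'u) edge \<Rightarrow> 'x vertex" where
  "edge_head I (SrcE x) = Node 1 x"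
| "edge_head I (Trans t x u) = Node (t + dur I x u) (succ_state I x u)"
| "edge_head I (SinkE x) = Terminal"

definition transitions :: "('x, 'u) mgt \<Rightarrow> ('x, 'u) edge set" where
  "transitions I = {Trans t x u | t x u.
     x \<in> states I \<and> u \<in> controls I x \<and> 1 \<le> t \<and> t + dur I x u \<le> horizon I}"

definition mgt_graph :: "('x, 'u) mgt \<Rightarrow> ('x vertex, ('x, 'u) edge) pre_digraph" where
  "mgt_graph I = \<lparr>
     verts = {Source, Terminal} \<union> {Node t x | t x. t \<in> {1..horizon I} \<and> x \<in> states I},
     arcs = transitions I \<union> SrcE ` states I \<union> SinkE ` states I,
     tail = edge_tail I,
     head = edge_head I\<rparr>"

definition st_paths :: "('x, 'u) mgt \<Rightarrow> ('x, 'u) edge list set" where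
  "st_paths I = {p. pre_digraph.apath (mgt_graph I) Source p Terminal}"

section \<open>Edge costs and the robust shortest-path value\<close>

definition stage_cost :: "('x, 'u) mgt \<Rightarrow> 'x \<Rightarrow> 'u \<Rightarrow> demand \<Rightarrow> nat \<Rightarrow> ereal" where
  "stage_cost I x u \<xi> t =
     util_P I t (fst \<xi> t - gen_P I x u) + util_H I t (snd \<xi> t - gen_H I x u)"

fun edge_cost :: "('x, 'u) mgt \<Rightarrow> ('x, 'u) edge \<Rightarrow> demand \<Rightarrow> ereal" where
  "edge_cost I (Trans t\<^sub>1 x u) \<xi> =
     ereal (op_cost I x u) + (\<Sum>t = t\<^sub>1..<t\<^sub>1 + dur I x u. stage_cost I x u \<xi> t)"
| "edge_cost I (SrcE x) \<xi> = 0"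
| "edge_cost I (SinkE x) \<xi> = 0"

definition uncertainty_set :: "('x, 'u) mgt \<Rightarrow> demand set" where
  "uncertainty_set I = {(P, H). \<exists>\<eta>P1 \<eta>Pinf \<eta>H1 \<eta>Hinf.
     (\<forall>t\<in>{1..horizon I}. P t = nom_P I t + \<eta>P1 t + \<eta>Pinf t \<and>
                          H t = nom_H I t + \<eta>H1 t + \<eta>Hinf t) \<and>
     (\<Sum>t = 1..horizon I. \<bar>wgt_P I t * \<eta>P1 t\<bar> + \<bar>wgt_H I t * \<eta>H1 t\<bar>) \<le> budget I \<and>
     (\<forall>t\<in>{1..horizon I}. \<bar>\<eta>Pinf t\<bar> \<le> dev_P I t \<and> \<bar>\<eta>Hinf t\<bar> \<le> dev_H I t)}"

definition V_star :: "('x, 'u) mgt \<Rightarrow> ereal" where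
  "V_star I = (INF p\<in>st_paths I. SUP \<xi>\<in>uncertainty_set I. \<Sum>e\<leftarrow>p. edge_cost I e \<xi>)"

section \<open>Bias and spike weights\<close>

definition bias_demand :: "('x, 'u) mgt \<Rightarrow> demand" where
  "bias_demand I = (\<lambda>t. nom_P I t + dev_P I t, \<lambda>t. nom_H I t + dev_H I t)"

definition spike_P :: "('x, 'u) mgt \<Rightarrow> nat \<Rightarrow> demand" where
  "spike_P I k =
     (\<lambda>t. fst (bias_demand I) t + (if k = t then budget I / wgt_P I t else 0), snd (bias_demand I))"

definition spike_H :: "('x, 'u) mgt \<Rightarrow> nat \<Rightarrow> demand" where
  "spike_H I k =
     (fst (bias_demand I), \<lambda>t. snd (bias_demand I) t + (if k = t then budget I / wgt_H I t else 0))"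

definition W_bias :: "('x, 'u) mgt \<Rightarrow> ('x, 'u) edge \<Rightarrow> ereal" where
  "W_bias I e = edge_cost I e (bias_demand I)"

text \<open>
  \<open>W_spike\<close> is only meaningful on transition edges; \<open>-\<infinity>\<close> on the others is neutral for maxima.
  If \<open>W_bias\<close> is infinite, then so is one of the two terms of the inner maximum for each \<open>k\<close>, and
  \<open>W_spike\<close> is \<open>\<infinity>\<close> because \<open>\<infinity> - \<infinity> = \<infinity>\<close> in type \<open>ereal\<close>.
\<close>

fun W_spike :: "('x, 'u) mgt \<Rightarrow> ('x, 'u) edge \<Rightarrow> ereal" where
  "W_spike I (Trans t\<^sub>1 x u) =
     Max ((\<lambda>k. max (edge_cost I (Trans t\<^sub>1 x u) (spike_P I k)) (edge_cost I (Trans t\<^sub>1 x u) (spike_H I k)))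
            ` {t\<^sub>1..<t\<^sub>1 + dur I x u}) - W_bias I (Trans t\<^sub>1 x u)"
| "W_spike I (SrcE x) = -\<infinity>"
| "W_spike I (SinkE x) = -\<infinity>"

text \<open>
  The extreme thresholds range over the transition edges with finite \<open>W_spike\<close>.  If all costs
  are finite these are all transition edges; an edge with infinite \<open>W_spike\<close> would make the largest
  threshold infinite, whereas thresholds are real numbers.
\<close>

definition finite_spikes :: "('x, 'u) mgt \<Rightarrow> ereal set" where
  "finite_spikes I = {W_spike I e | e. e \<in> transitions I \<and> W_spike I e < \<infinity>}"

definition W_min :: "('x, 'u) mgt \<Rightarrow> ereal" where
  "W_min I = Min (finite_spikes I)"

definition W_max :: "('x, 'u) mgt \<Rightarrow> ereal" where
  "W_max I = Max (finite_spikes I)"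

definition Thresh :: "('x, 'u) mgt \<Rightarrow> real \<Rightarrow> ereal set" where
  "Thresh I \<epsilon> =
     {W_min I + ereal (real k * \<epsilon>) | k. W_min I + ereal (real k * \<epsilon>) \<le> W_max I} \<union> {W_max I}"

section \<open>Standing assumptions\<close>

definition mgt_model :: "('x, 'u) mgt \<Rightarrow> bool" where
  "mgt_model I \<longleftrightarrow>
     finite (states I) \<and> finite (arcs (mgt_graph I)) \<and>
     (\<forall>x\<in>states I. \<forall>u\<in>controls I x. succ_state I x u \<in> states I \<and> 1 \<le> dur I x u) \<and>
     (\<forall>t\<in>{1..horizon I}. utility_cost (util_P I t) \<and> utility_cost (util_H I t) \<and>
        (\<forall>x<0. util_H I t x = 0)) \<and>
     0 \<le> budget I \<and>
     (\<forall>t\<in>{1..horizon I}. 0 \<le> dev_P I t \<and> 0 \<le> dev_H I t \<and> 0 < wgt_P I t \<and> 0 < wgt_H I t)"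

text \<open>The minima and maxima in the problem and in the algorithm are over nonempty sets.\<close>

definition well_posed :: "('x, 'u) mgt \<Rightarrow> bool" where
  "well_posed I \<longleftrightarrow> st_paths I \<noteq> {} \<and> finite_spikes I \<noteq> {}"

text \<open>
  A utility cost that is infinite to the left (no selling) is monotone only where it is finite, so
  an edge may have finite cost at the bias demand and at all spikes and yet infinite cost at a
  smaller demand in the uncertainty set.  The weights \<open>W_bias\<close> and \<open>W_spike\<close> do not see this, and
  for a path through such an edge they do not give the worst case (take \<open>T = 2\<close>, one state and one
  control without generation, \<open>util_P I 1 x\<close> equal to \<open>x\<close> for \<open>x \<ge> 0\<close> and to \<open>\<infinity>\<close> for \<open>x < 0\<close>,
  zero heat costs, \<open>nom_P I 1 = 0\<close>, \<open>dev_P I 1 = 1\<close>, \<open>budget I = 0\<close>: the algorithm returns \<open>1\<close>,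
  the robust value is \<open>\<infinity>\<close>).  Such edges are excluded; edges with infinite \<open>W_spike\<close> are not.
\<close>

definition no_hidden_infinity :: "('x, 'u) mgt \<Rightarrow> bool" where
  "no_hidden_infinity I \<longleftrightarrow> (\<forall>e\<in>transitions I. W_spike I e < \<infinity> \<longrightarrow>
     (\<forall>\<xi>\<in>uncertainty_set I. edge_cost I e \<xi> < \<infinity>))"

section \<open>The algorithm\<close>

definition threshold_weight :: "('x, 'u) mgt \<Rightarrow> ereal \<Rightarrow> ('x, 'u) edge \<Rightarrow> ereal" where
  "threshold_weight I \<alpha> e = (if is_Trans e \<and> \<alpha> < W_spike I e then \<infinity> else W_bias I e)"

definition path_weight :: "('x, 'u) mgt \<Rightarrow> ereal \<Rightarrow> ('x, 'u) edge list \<Rightarrow> ereal" where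
  "path_weight I \<alpha> p = (\<Sum>e\<leftarrow>p. threshold_weight I \<alpha> e)"

definition path_spike :: "('x, 'u) mgt \<Rightarrow> ('x, 'u) edge list \<Rightarrow> ereal" where
  "path_spike I p = Max (W_spike I ` {e \<in> set p. is_Trans e})"

definition path_value :: "('x, 'u) mgt \<Rightarrow> ('x, 'u) edge list \<Rightarrow> ereal" where
  "path_value I p = (\<Sum>e\<leftarrow>p. W_bias I e) + path_spike I p"

definition shortest_path :: "('x, 'u) mgt \<Rightarrow> ereal \<Rightarrow> ('x, 'u) edge list \<Rightarrow> bool" where
  "shortest_path I \<alpha> p \<longleftrightarrow> p \<in> st_paths I \<and>
     (\<forall>q\<in>st_paths I. path_weight I \<alpha> p < path_weight I \<alpha> q \<or>
        path_weight I \<alpha> p = path_weight I \<alpha> q \<and> path_spike I p \<le> path_spike I q)"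

text \<open>
  \<open>algorithm_A I S v p\<close>: with threshold set \<open>S\<close> the algorithm may return value \<open>v\<close> and path \<open>p\<close>,
  for some choice among the remaining ties.
\<close>

definition algorithm_A ::
    "('x, 'u) mgt \<Rightarrow> ereal set \<Rightarrow> ereal \<Rightarrow> ('x, 'u) edge list \<Rightarrow> bool" where
  "algorithm_A I S v p \<longleftrightarrow> (\<exists>V_path.
     (\<forall>\<alpha>\<in>S. shortest_path I \<alpha> (V_path \<alpha>)) \<and>
     (\<exists>\<gamma>\<in>S. (\<forall>\<beta>\<in>S. path_value I (V_path \<gamma>) \<le> path_value I (V_path \<beta>)) \<and>
        v = path_value I (V_path \<gamma>) \<and> p = V_path \<gamma>))"

section \<open>A step-counting implementation\<close>

text \<open>
  A program returns its result together with the number of elementary steps.  One step is a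
  bounded number of arithmetic operations and comparisons on extended reals, evaluations of the
  model data (including \<open>util_P\<close> and \<open>util_H\<close>) at one argument, list-cell operations, and reads
  or writes of a table indexed by vertices.
\<close>

type_synonym 'a timed = "'a \<times> nat"

definition step :: "'a \<Rightarrow> 'a timed" where
  "step a = (a, 1)"

definition bind_timed :: "'a timed \<Rightarrow> ('a \<Rightarrow> 'b timed) \<Rightarrow> 'b timed" where
  "bind_timed m g = (fst (g (fst m)), snd m + snd (g (fst m)))"

adhoc_overloading Monad_Syntax.bind \<rightleftharpoons> bind_timed

fun loop :: "('a \<Rightarrow> 's \<Rightarrow> 's timed) \<Rightarrow> 'a list \<Rightarrow> 's \<Rightarrow> 's timed" where
  "loop g [] s = step s"
| "loop g (x # xs) s = do { s' \<leftarrow> step s; s'' \<leftarrow> g x s'; loop g xs s'' }"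

fun map_timed :: "('a \<Rightarrow> 'b timed) \<Rightarrow> 'a list \<Rightarrow> 'b list timed" where
  "map_timed g [] = step []"
| "map_timed g (x # xs) = do { y \<leftarrow> g x; ys \<leftarrow> map_timed g xs; step (y # ys) }"

fun edge_cost_prog :: "('x, 'u) mgt \<Rightarrow> ('x, 'u) edge \<Rightarrow> demand \<Rightarrow> ereal timed" where
  "edge_cost_prog I (Trans t\<^sub>1 x u) \<xi> =
     loop (\<lambda>t acc. step (acc + stage_cost I x u \<xi> t)) [t\<^sub>1..<t\<^sub>1 + dur I x u] (ereal (op_cost I x u))"
| "edge_cost_prog I (SrcE x) \<xi> = step 0"
| "edge_cost_prog I (SinkE x) \<xi> = step 0"

text \<open>Two ways to obtain \<open>(W_bias, W_spike)\<close> of an edge: by direct evaluation of the defining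
  formulas, or from an oracle that delivers both numbers in one step.\<close>

fun weights_prog :: "('x, 'u) mgt \<Rightarrow> ('x, 'u) edge \<Rightarrow> (ereal \<times> ereal) timed" where
  "weights_prog I (Trans t\<^sub>1 x u) = do {
     b \<leftarrow> edge_cost_prog I (Trans t\<^sub>1 x u) (bias_demand I);
     m \<leftarrow> loop (\<lambda>k acc. do {
            cp \<leftarrow> edge_cost_prog I (Trans t\<^sub>1 x u) (spike_P I k);
            ch \<leftarrow> edge_cost_prog I (Trans t\<^sub>1 x u) (spike_H I k);
            step (max acc (max cp ch)) }) [t\<^sub>1..<t\<^sub>1 + dur I x u] (-\<infinity>);
     step (b, m - b) }"
| "weights_prog I (SrcE x) = step (0, -\<infinity>)"
| "weights_prog I (SinkE x) = step (0, -\<infinity>)"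

definition weights_oracle :: "('x, 'u) mgt \<Rightarrow> ('x, 'u) edge \<Rightarrow> (ereal \<times> ereal) timed" where
  "weights_oracle I e = step (W_bias I e, W_spike I e)"

text \<open>
  Dynamic programming along a list of all edges in topological order.  The label of a vertex \<open>v\<close>
  is \<open>(d, b, s, p)\<close> for the best walk from the source to \<open>v\<close> found so far: its threshold weight, its
  \<open>W_bias\<close>-weight, its maximal \<open>W_spike\<close>, and its edges in reverse.  Vertices that have not been
  reached have no label, so no time is spent on isolated vertices.
\<close>

type_synonym ('x, 'u) label = "ereal \<times> ereal \<times> ereal \<times> ('x, 'u) edge list"
type_synonym ('x, 'u) entry = "('x, 'u) edge \<times> ereal \<times> ereal"

fun better :: "('x, 'u) label \<Rightarrow> ('x, 'u) label option \<Rightarrow> bool" where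
  "better l None = True"
| "better (d, b, s, p) (Some (d', b', s', p')) \<longleftrightarrow> d < d' \<or> d = d' \<and> s < s'"

fun extend :: "ereal \<Rightarrow> ('x, 'u) entry \<Rightarrow> ('x, 'u) label \<Rightarrow> ('x, 'u) label" where
  "extend \<alpha> (e, b, s) (d, b', s', p) =
     (d + (if is_Trans e \<and> \<alpha> < s then \<infinity> else b), b' + b, max s' s, e # p)"

definition relax :: "('x, 'u) mgt \<Rightarrow> ereal \<Rightarrow> ('x, 'u) entry \<Rightarrow>
    ('x vertex \<Rightarrow> ('x, 'u) label option) \<Rightarrow> ('x vertex \<Rightarrow> ('x, 'u) label option) timed" where
  "relax I \<alpha> a M = step (case M (edge_tail I (fst a)) of
      None \<Rightarrow> M
    | Some l \<Rightarrow> if better (extend \<alpha> a l) (M (edge_head I (fst a)))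
                then M(edge_head I (fst a) \<mapsto> extend \<alpha> a l) else M)"

text \<open>The result is the value of the path found, and this path in reverse.\<close>

definition shortest_path_prog :: "('x, 'u) mgt \<Rightarrow> ('x, 'u) entry list \<Rightarrow> ereal \<Rightarrow>
    (ereal \<times> ('x, 'u) edge list) timed" where
  "shortest_path_prog I tbl \<alpha> = do {
     M \<leftarrow> loop (relax I \<alpha>) tbl [Source \<mapsto> (0, 0, -\<infinity>, [])];
     step (case M Terminal of None \<Rightarrow> (\<infinity>, []) | Some (d, b, s, p) \<Rightarrow> (b + s, p)) }"

definition range_prog :: "('x, 'u) entry list \<Rightarrow> (ereal \<times> ereal) timed" where
  "range_prog tbl = loop (\<lambda>(e, b, s) (lo, hi).
     step (if is_Trans e \<and> s < \<infinity> then (min lo s, max hi s) else (lo, hi))) tbl (\<infinity>, -\<infinity>)"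

text \<open>
  The arguments are the procedure delivering the edge weights, the list of edges, and the
  threshold spacing.  The thresholds below the largest one are \<open>lo + k \<epsilon>\<close> for
  \<open>k < \<lceil>(hi - lo) / \<epsilon>\<rceil>\<close>; the search starts from the largest threshold.
\<close>

definition algorithm_prog :: "('x, 'u) mgt \<Rightarrow> (('x, 'u) edge \<Rightarrow> (ereal \<times> ereal) timed) \<Rightarrow>
    ('x, 'u) edge list \<Rightarrow> real \<Rightarrow> (ereal \<times> ('x, 'u) edge list) timed" where
  "algorithm_prog I weights es \<epsilon> = do {
     tbl \<leftarrow> map_timed (\<lambda>e. do { (b, s) \<leftarrow> weights e; step (e, b, s) }) es;
     (lo, hi) \<leftarrow> range_prog tbl;
     n \<leftarrow> step (nat \<lceil>real_of_ereal (hi - lo) / \<epsilon>\<rceil>);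
     first \<leftarrow> shortest_path_prog I tbl hi;
     (v, p) \<leftarrow> loop (\<lambda>k best. do {
         cand \<leftarrow> shortest_path_prog I tbl (lo + ereal (real k * \<epsilon>));
         step (if fst cand < fst best then cand else best) }) [0..<n] first;
     p' \<leftarrow> loop (\<lambda>e acc. step (e # acc)) p [];
     step (v, p') }"

text \<open>
  The input: all edges, each once, such that every edge entering a vertex precedes every edge
  leaving it (for instance, in order of their starting times).
\<close>

definition edge_list :: "('x, 'u) mgt \<Rightarrow> ('x, 'u) edge list \<Rightarrow> bool" where
  "edge_list I es \<longleftrightarrow> distinct es \<and> set es = arcs (mgt_graph I) \<and>
     sorted_wrt (\<lambda>e e'. edge_head I e' \<noteq> edge_tail I e) es"

definition max_dur :: "('x, 'u) mgt \<Rightarrow> nat" where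
  "max_dur I = Max {dur I x u | t x u. Trans t x u \<in> transitions I}"

text \<open>
  If \<open>W_max I = W_min I\<close>, the quotient below is \<open>0\<close>, but one shortest-path problem is still solved,
  so the number of rounds is counted as at least one.
\<close>

definition rounds :: "('x, 'u) mgt \<Rightarrow> real \<Rightarrow> nat" where
  "rounds I \<epsilon> = max 1 (nat \<lceil>real_of_ereal (W_max I - W_min I) / \<epsilon>\<rceil>)"

end

theory Submission
  imports Defs
begin

text \<open>
  Write the value of a path as its total bias weight plus its largest spike weight.  The first point
  is that this is the robust cost of the path (\<open>robust_cost_eq_path_value\<close>).  By monotonicity the
  adversary uses the bounded deviations \<open>\<Delta>P\<close> and \<open>\<Delta>H\<close> in full.  It remains to distribute the budget
  \<open>\<mu>\<^sub>1\<close> over the times and over power and heat.  The cost is convex in each coordinate, so spending a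
  fraction \<open>l\<close> of the budget in one coordinate costs at most \<open>l\<close> times what spending all of it there
  costs (\<open>utility_cost_chord\<close>).  The fractions sum to at most one, so it is best to spend the whole
  budget in a single coordinate, and the best such coordinate gives the largest spike weight.  For
  costs with infinite values, the upper bound needs every edge of finite spike weight to be
  affordable on the whole uncertainty set; a path with an edge of infinite spike weight is
  unaffordable at some spike or at the bias demand, and both of its values are infinite.

  So the robust problem asks for a path with the least sum of bias weights plus the maximum of spike
  weights.  If the maximum is known to be at most \<open>\<alpha>\<close>, the problem becomes a shortest-path problem
  for the bias weights on the edges of spike weight at most \<open>\<alpha>\<close>.  Let
  \<open>\<alpha>\<close> be the spike weight of a given path \<open>q\<close>, rounded up to a threshold.  The shortest path for \<open>\<alpha>\<close> has no larger bias
  weight than \<open>q\<close>, and a spike weight of at most \<open>\<alpha>\<close>, which exceeds that of \<open>q\<close> by at most \<open>\<epsilon>\<close>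
  (\<open>Thresh_rounds_up\<close>, \<open>shortest_path_value_le\<close>).  This gives \<open>v \<le> V\<^sup>\<star> + \<epsilon>\<close>; the other inequality
  holds because \<open>v\<close> is the value of some path.

  The implementation relaxes the edges in topological order, with labels ordered
  by weight and then by largest spike.  A label that is best for a vertex remains best when an edge
  is appended.  For edges of infinite weight this is not automatic, but it holds for the weights
  at hand (\<open>no_worse_snoc\<close>), because infinite weight and a spike above the threshold occur
  together.  Hence one pass solves the shortest-path problem with the required tie-breaking, in
  a constant number of steps per edge, and there is one pass per threshold.
\<close>

section \<open>Convex costs with infinite values\<close>

lemma utility_cost_mono:
  "utility_cost C \<Longrightarrow> C x < \<infinity> \<Longrightarrow> x \<le> y \<Longrightarrow> C x \<le> C y"
  unfolding utility_cost_def by (cases "C y < \<infinity>") (auto simp: top.not_eq_extremum)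

text \<open>At \<open>b + l s\<close> the bound is convexity.  It also shows that the cost is finite there, so that
  monotonicity carries it over to every affordable \<open>x\<close> below.\<close>

lemma utility_cost_chord:
  assumes C: "utility_cost C" and fin: "C b < \<infinity>" "C (b + s) < \<infinity>" "C x < \<infinity>"
    and l: "0 \<le> l" "l \<le> 1" and x: "x \<le> b + l * s"
  shows "real_of_ereal (C x) \<le>
    real_of_ereal (C b) + l * (real_of_ereal (C (b + s)) - real_of_ereal (C b))"
proof -
  have MInf: "C y \<noteq> -\<infinity>" for y
    using C by (simp add: utility_cost_def)
  obtain cb cs cx where c: "C b = ereal cb" "C (b + s) = ereal cs" "C x = ereal cx"
    using fin MInf by (metis ereal_cases less_irrefl)
  have "C (b + l * s) \<le> ereal ((1 - l) * cb + l * cs)"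
  proof (cases "l = 0 \<or> l = 1")
    case False
    then have "C ((1 - l) * b + l * (b + s)) \<le> ereal (1 - l) * C b + ereal l * C (b + s)"
      using C l by (simp add: utility_cost_def ereal_convex_def)
    then show ?thesis
      by (simp add: c algebra_simps)
  qed (auto simp: c)
  moreover have "C x \<le> C (b + l * s)"
    using C fin(3) x by (rule utility_cost_mono)
  ultimately have "C x \<le> ereal ((1 - l) * cb + l * cs)"
    by (rule order_trans[rotated])
  then show ?thesis
    by (simp add: c algebra_simps)
qed

lemma sum_not_MInf: "(\<And>k. k \<in> A \<Longrightarrow> f k \<noteq> -\<infinity>) \<Longrightarrow> sum f A \<noteq> (-\<infinity> :: ereal)"
  by (induction A rule: infinite_finite_induct) auto

lemma sum_list_eq_PInf: "(\<Sum>e\<leftarrow>p. f e) = (\<infinity> :: ereal) \<longleftrightarrow> (\<exists>e\<in>set p. f e = \<infinity>)"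
  by (induction p) auto

section \<open>Step-counting loops\<close>

lemma fst_step [simp]: "fst (step a) = a" and snd_step [simp]: "snd (step a) = 1"
  by (simp_all add: step_def)

lemma fst_bind [simp]: "fst (bind_timed m g) = fst (g (fst m))"
  and snd_bind [simp]: "snd (bind_timed m g) = snd m + snd (g (fst m))"
  by (simp_all add: bind_timed_def)

lemma snd_loop:
  assumes "\<And>x s. x \<in> set xs \<Longrightarrow> snd (g x s) \<le> B"
  shows "snd (loop g xs s) \<le> length xs * (B + 1) + 1"
  using assms
proof (induction xs arbitrary: s)
  case (Cons x xs)
  have "snd (g x s) \<le> B" "snd (loop g xs (fst (g x s))) \<le> length xs * (B + 1) + 1"
    using Cons by simp_all
  then show ?case
    by simp
qed simp

lemma fst_map_timed: "fst (map_timed g xs) = map (\<lambda>x. fst (g x)) xs"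
  by (induction xs) simp_all

lemma snd_map_timed:
  "(\<And>x. x \<in> set xs \<Longrightarrow> snd (g x) \<le> B) \<Longrightarrow> snd (map_timed g xs) \<le> length xs * (B + 1) + 1"
proof (induction xs)
  case (Cons x xs)
  have "snd (g x) \<le> B" "snd (map_timed g xs) \<le> length xs * (B + 1) + 1"
    using Cons by simp_all
  then show ?case
    by simp
qed simp

lemma fst_sum_loop: "fst (loop (\<lambda>k acc. step (acc + f k)) ks a) = a + (\<Sum>k\<leftarrow>ks. f k)"
  for f :: "'k \<Rightarrow> ereal"
  by (induction ks arbitrary: a) (simp_all add: add.assoc)

lemma fst_max_loop:
  fixes a :: ereal
  assumes "\<And>k acc. fst (g k acc) = max acc (f k)"
  shows "fst (loop g ks a) = max a (SUP k\<in>set ks. f k)"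
  by (induction ks arbitrary: a) (simp_all add: assms max.assoc bot_ereal_def sup_max)

lemma best_loop:
  fixes f :: "'k \<Rightarrow> (ereal \<times> 'p) timed"
  defines "body \<equiv> \<lambda>k best. bind_timed (f k) (\<lambda>cand. step (if fst cand < fst best then cand else best))"
  shows "fst (loop body ks a) \<in> insert a ((\<lambda>k. fst (f k)) ` set ks) \<and>
    (\<forall>r\<in>insert a ((\<lambda>k. fst (f k)) ` set ks). fst (fst (loop body ks a)) \<le> fst r)"
proof (induction ks arbitrary: a)
  case (Cons k ks)
  let ?a = "if fst (fst (f k)) < fst a then fst (f k) else a"
  have eq: "fst (loop body (k # ks) a) = fst (loop body ks ?a)"
    by (simp add: body_def)
  show ?case
    using Cons.IH[of ?a] unfolding eq by (auto split: if_splits)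
qed simp

lemma reverse_loop: "fst (loop (\<lambda>e acc. step (e # acc)) p q) = rev p @ q"
  by (induction p arbitrary: q) simp_all

text \<open>For an edge of duration \<open>c\<close>: one cost evaluation at the bias demand takes \<open>2 c + 1\<close> steps, and
  each of the \<open>c\<close> iterations over the spikes takes two evaluations and two more steps.\<close>

definition weights_steps :: "nat \<Rightarrow> nat" where
  "weights_steps c = (2 * c + 1) + (c * (4 * c + 4) + 1) + 1"

section \<open>Walks in the transition graph\<close>

locale turbine =
  fixes I :: "('x, 'u) mgt"
  assumes model: "mgt_model I"
begin

abbreviation E :: "('x, 'u) edge set" where
  "E \<equiv> arcs (mgt_graph I)"

definition walk :: "'x vertex \<Rightarrow> ('x, 'u) edge list \<Rightarrow> 'x vertex \<Rightarrow> bool" where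
  "walk u p v \<longleftrightarrow> set p \<subseteq> E \<and> pre_digraph.cas (mgt_graph I) u p v"

lemma tail_graph [simp]: "tail (mgt_graph I) = edge_tail I"
  and head_graph [simp]: "head (mgt_graph I) = edge_head I"
  by (simp_all add: mgt_graph_def)

lemma edge_cases:
  assumes "e \<in> E"
  obtains (trans) t x u where "e = Trans t x u" "e \<in> transitions I" "x \<in> states I"
      "u \<in> controls I x" "1 \<le> t" "1 \<le> dur I x u" "t + dur I x u \<le> horizon I"
    | (src) x where "e = SrcE x" "x \<in> states I"
    | (sink) x where "e = SinkE x" "x \<in> states I"
  using assms model by (fastforce simp: mgt_graph_def transitions_def mgt_model_def)

lemma transitions_iff: "e \<in> transitions I \<longleftrightarrow> e \<in> E \<and> is_Trans e"
  by (auto simp: mgt_graph_def transitions_def)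

lemma finite_E: "finite E"
  using model by (simp add: mgt_model_def)

lemma finite_transitions: "finite (transitions I)"
  using finite_E by (simp add: mgt_graph_def)

lemma walk_Nil [simp]: "walk u [] v \<longleftrightarrow> u = v"
  by (simp add: walk_def pre_digraph.cas.simps)

lemma walk_Cons [simp]:
  "walk u (e # p) v \<longleftrightarrow> e \<in> E \<and> edge_tail I e = u \<and> walk (edge_head I e) p v"
  by (auto simp: walk_def pre_digraph.cas.simps)

lemma walk_append: "walk u (p @ q) v \<longleftrightarrow> (\<exists>w. walk u p w \<and> walk w q v)"
  by (induction p arbitrary: u) auto

lemma walk_edges: "walk u p v \<Longrightarrow> set p \<subseteq> E"
  by (simp add: walk_def)

primrec rank :: "'x vertex \<Rightarrow> nat" where
  "rank Source = 0"
| "rank (Node t x) = t"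
| "rank Terminal = Suc (horizon I)"

text \<open>Every edge moves forward in time, so the graph is acyclic and a walk repeats neither a vertex
  nor an edge.\<close>

lemma rank_edge: "e \<in> E \<Longrightarrow> rank (edge_tail I e) < rank (edge_head I e)"
  by (erule edge_cases) auto

lemma rank_walk_verts:
  "walk u p v \<Longrightarrow> w \<in> set (pre_digraph.awalk_verts (mgt_graph I) u p) \<Longrightarrow> rank u \<le> rank w"
proof (induction p arbitrary: u)
  case (Cons e p)
  then show ?case
    using rank_edge[of e] by (fastforce simp: pre_digraph.awalk_verts.simps)
qed (simp add: pre_digraph.awalk_verts.simps)

lemma distinct_walk_verts:
  "walk u p v \<Longrightarrow> distinct (pre_digraph.awalk_verts (mgt_graph I) u p)"
proof (induction p arbitrary: u)
  case (Cons e p)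
  then show ?case
    using rank_edge[of e] rank_walk_verts[of "edge_head I e" p v "edge_tail I e"]
    by (auto simp: pre_digraph.awalk_verts.simps)
qed (simp add: pre_digraph.awalk_verts.simps)

lemma st_paths_iff: "p \<in> st_paths I \<longleftrightarrow> walk Source p Terminal"
proof -
  have "Source \<in> verts (mgt_graph I)"
    by (simp add: mgt_graph_def)
  then show ?thesis
    using distinct_walk_verts[of Source p Terminal]
    by (auto simp: st_paths_def pre_digraph.apath_def pre_digraph.awalk_def walk_def)
qed

lemma distinct_walk:
  assumes "walk u p v"
  shows "distinct p"
  using distinct_walk_verts[OF assms]
  by (auto simp: pre_digraph.awalk_verts_conv distinct_map split: if_splits)

lemma length_walk: "walk u p v \<Longrightarrow> length p \<le> card E"
  using distinct_walk[of u p v] walk_edges[of u p v] card_mono[OF finite_E, of "set p"]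
  by (simp add: distinct_card)

lemma finite_st_paths: "finite (st_paths I)"
proof (rule finite_subset)
  show "st_paths I \<subseteq> {p. set p \<subseteq> E \<and> length p \<le> card E}"
    using walk_edges length_walk by (fastforce simp: st_paths_iff)
qed (rule finite_lists_length_le[OF finite_E])

text \<open>A transition edge needs a horizon of at least two, and then no source edge ends where a
  sink edge starts.  So the maximal spike weight of a path is over a nonempty set.\<close>

lemma path_has_transition:
  assumes wp: "well_posed I" and p: "p \<in> st_paths I"
  shows "\<exists>e\<in>set p. is_Trans e"
proof -
  from wp obtain e where "e \<in> transitions I"
    by (auto simp: well_posed_def finite_spikes_def)
  then have T: "horizon I \<ge> 2"
    using model by (fastforce simp: transitions_def mgt_model_def)
  from p obtain e q where pe: "p = e # q"
    by (cases p) (auto simp: st_paths_iff)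
  with p obtain x where e: "e = SrcE x" "walk (Node 1 x) q Terminal"
    by (auto simp: st_paths_iff elim!: edge_cases)
  then obtain e' q' where q: "q = e' # q'"
    by (cases q) auto
  have "is_Trans e'"
    using e(2) T unfolding q by (auto elim!: edge_cases)
  then show ?thesis
    by (auto simp: pe q)
qed

primrec load :: "(nat \<Rightarrow> real) \<Rightarrow> ('x, 'u) edge \<Rightarrow> real" where
  "load l (Trans t x u) = (\<Sum>k = t..<t + dur I x u. l k)"
| "load l (SrcE x) = 0"
| "load l (SinkE x) = 0"

lemma walk_from_Terminal: "walk Terminal p v \<Longrightarrow> p = []"
  by (cases p) (auto elim!: edge_cases)

text \<open>The transition edges of a path occupy consecutive disjoint time intervals.  This is why
  budget spent at different times of the horizon is not counted twice along a path.\<close>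

lemma load_walk_from_Node:
  "walk (Node t x) p Terminal \<Longrightarrow> (\<Sum>e\<leftarrow>p. load l e) = (\<Sum>k = t..<horizon I. l k)"
proof (induction p arbitrary: t x)
  case (Cons e p)
  then have "e \<in> E" by simp
  then show ?case
  proof (cases rule: edge_cases)
    case (trans t' y u)
    then show ?thesis
      using Cons by (auto simp: sum.atLeastLessThan_concat)
  next
    case (sink y)
    then have "p = []" "t = horizon I"
      using Cons walk_from_Terminal[of p Terminal] by auto
    then show ?thesis
      using sink by simp
  qed (use Cons in auto)
qed simp

lemma load_path:
  assumes "p \<in> st_paths I"
  shows "(\<Sum>e\<leftarrow>p. load l e) = (\<Sum>k = 1..<horizon I. l k)"
proof -
  from assms obtain e q where "p = e # q"
    by (cases p) (auto simp: st_paths_iff)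
  with assms obtain x where "e = SrcE x" "walk (Node 1 x) q Terminal"
    by (auto simp: st_paths_iff elim!: edge_cases)
  then show ?thesis
    using load_walk_from_Node[of 1 x q l] \<open>p = e # q\<close> by simp
qed

section \<open>The robust cost of a path\<close>

lemma util_costs:
  assumes "k \<in> {1..horizon I}"
  shows "utility_cost (util_P I k)" "utility_cost (util_H I k)"
    "util_P I k y \<noteq> -\<infinity>" "util_H I k y \<noteq> -\<infinity>"
  using model assms by (auto simp: mgt_model_def utility_cost_def)

lemma wgt_pos: "k \<in> {1..horizon I} \<Longrightarrow> 0 < wgt_P I k" "k \<in> {1..horizon I} \<Longrightarrow> 0 < wgt_H I k"
  using model by (auto simp: mgt_model_def)

lemma budget_nonneg: "0 \<le> budget I"
  using model by (simp add: mgt_model_def)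

lemma transition_cases:
  assumes "e \<in> transitions I"
  obtains t x u where "e = Trans t x u" "1 \<le> dur I x u" "{t..<t + dur I x u} \<subseteq> {1..horizon I}"
proof -
  from assms have "e \<in> E" "is_Trans e"
    by (simp_all add: transitions_iff)
  then show thesis
    by (cases rule: edge_cases) (auto intro!: that)
qed

lemma edge_cost_eq_PInf:
  "edge_cost I (Trans t x u) \<xi> = \<infinity> \<longleftrightarrow> (\<exists>k\<in>{t..<t + dur I x u}.
     util_P I k (fst \<xi> k - gen_P I x u) = \<infinity> \<or> util_H I k (snd \<xi> k - gen_H I x u) = \<infinity>)"
  by (auto simp: stage_cost_def sum_Pinfty)

lemma edge_cost_not_MInf:
  assumes "e \<in> E"
  shows "edge_cost I e \<xi> \<noteq> -\<infinity>"
  using assms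
proof (cases rule: edge_cases)
  case (trans t x u)
  then have "stage_cost I x u \<xi> k \<noteq> -\<infinity>" if "k \<in> {t..<t + dur I x u}" for k
    using that util_costs[of k] by (auto simp: stage_cost_def)
  then show ?thesis
    using sum_not_MInf[of "{t..<t + dur I x u}" "stage_cost I x u \<xi>"] trans by auto
qed auto

lemma W_bias_not_MInf: "e \<in> E \<Longrightarrow> W_bias I e \<noteq> -\<infinity>"
  by (simp add: W_bias_def edge_cost_not_MInf)

text \<open>No stage cost is \<open>-\<infinity>\<close>, so a finite edge cost has only finite stages.  This reduces the convexity
  argument to real arithmetic.\<close>

lemma edge_cost_real:
  assumes e: "Trans t x u \<in> transitions I" and fin: "edge_cost I (Trans t x u) \<xi> < \<infinity>"
  shows "edge_cost I (Trans t x u) \<xi> = ereal (op_cost I x u + (\<Sum>k = t..<t + dur I x u.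
    real_of_ereal (util_P I k (fst \<xi> k - gen_P I x u)) +
    real_of_ereal (util_H I k (snd \<xi> k - gen_H I x u))))"
proof -
  have "stage_cost I x u \<xi> k = ereal (real_of_ereal (util_P I k (fst \<xi> k - gen_P I x u)) +
      real_of_ereal (util_H I k (snd \<xi> k - gen_H I x u)))" if k: "k \<in> {t..<t + dur I x u}" for k
  proof -
    have "k \<in> {1..horizon I}"
      using e k by (auto simp: transitions_def)
    moreover have "util_P I k (fst \<xi> k - gen_P I x u) \<noteq> \<infinity>" "util_H I k (snd \<xi> k - gen_H I x u) \<noteq> \<infinity>"
      using fin k edge_cost_eq_PInf[of t x u \<xi>] by (auto simp del: edge_cost.simps)
    ultimately show ?thesis
      using util_costs(3,4)[of k]
      by (cases "util_P I k (fst \<xi> k - gen_P I x u)"; cases "util_H I k (snd \<xi> k - gen_H I x u)")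
        (auto simp: stage_cost_def)
  qed
  then show ?thesis
    by simp
qed

lemma edge_cost_mono:
  assumes e: "e \<in> E" and fin: "edge_cost I e \<xi> < \<infinity>"
    and le: "\<And>k. k \<in> {1..horizon I} \<Longrightarrow> fst \<xi> k \<le> fst \<xi>' k \<and> snd \<xi> k \<le> snd \<xi>' k"
  shows "edge_cost I e \<xi> \<le> edge_cost I e \<xi>'"
  using e
proof (cases rule: edge_cases)
  case (trans t x u)
  have "stage_cost I x u \<xi> k \<le> stage_cost I x u \<xi>' k" if k: "k \<in> {t..<t + dur I x u}" for k
  proof -
    have "util_P I k (fst \<xi> k - gen_P I x u) \<noteq> \<infinity>" "util_H I k (snd \<xi> k - gen_H I x u) \<noteq> \<infinity>"
      using fin k edge_cost_eq_PInf[of t x u \<xi>] trans(1) by (auto simp del: edge_cost.simps)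
    moreover have "k \<in> {1..horizon I}"
      using trans k by auto
    ultimately show ?thesis
      unfolding stage_cost_def using le[of k] util_costs[of k]
      by (intro add_mono utility_cost_mono) auto
  qed
  then show ?thesis
    using trans(1) by (auto intro!: add_mono sum_mono)
qed auto

lemma bias_le_spike:
  assumes "k' \<in> {1..horizon I}"
  shows "fst (bias_demand I) k' \<le> fst (spike_P I k) k'" "snd (bias_demand I) k' \<le> snd (spike_P I k) k'"
    "fst (bias_demand I) k' \<le> fst (spike_H I k) k'" "snd (bias_demand I) k' \<le> snd (spike_H I k) k'"
  using assms budget_nonneg wgt_pos[of k'] by (auto simp: spike_P_def spike_H_def)

text \<open>A power spike leaves the heat demand alone and vice versa.  So an edge that is unaffordable
  at the bias demand is so at one of the two spikes as well, and the subtraction in \<open>W_spike\<close>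
  never turns a finite maximum into \<open>-\<infinity>\<close>.\<close>

lemma W_bias_plus_W_spike:
  assumes "Trans t x u \<in> transitions I"
  shows "W_bias I (Trans t x u) + W_spike I (Trans t x u) =
    Max ((\<lambda>k. max (edge_cost I (Trans t x u) (spike_P I k)) (edge_cost I (Trans t x u) (spike_H I k)))
      ` {t..<t + dur I x u})" (is "?b + _ = Max (?f ` ?K)")
proof (cases "?b = \<infinity>")
  case True
  then obtain j where "j \<in> ?K" and
    "util_P I j (fst (bias_demand I) j - gen_P I x u) = \<infinity> \<or>
     util_H I j (snd (bias_demand I) j - gen_H I x u) = \<infinity>"
    unfolding W_bias_def edge_cost_eq_PInf by blast
  then have "edge_cost I (Trans t x u) (spike_H I j) = \<infinity> \<or> edge_cost I (Trans t x u) (spike_P I j) = \<infinity>"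
    unfolding edge_cost_eq_PInf by (auto simp only: spike_P_def spike_H_def fst_conv snd_conv)
  then have "?f j = \<infinity>"
    by (auto simp: max_def simp del: edge_cost.simps)
  moreover have "?f j \<le> Max (?f ` ?K)"
    using \<open>j \<in> ?K\<close> by (intro Max_ge) auto
  ultimately show ?thesis
    using True by (auto simp del: edge_cost.simps)
next
  case False
  then obtain b where "?b = ereal b"
    using assms W_bias_not_MInf[of "Trans t x u"] transitions_iff by (cases ?b) auto
  then show ?thesis
    by (cases "Max (?f ` ?K)") (auto simp del: edge_cost.simps)
qed

lemma spike_le:
  assumes "Trans t x u \<in> transitions I" "k \<in> {t..<t + dur I x u}"
  shows "edge_cost I (Trans t x u) (spike_P I k) \<le> W_bias I (Trans t x u) + W_spike I (Trans t x u)"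
    "edge_cost I (Trans t x u) (spike_H I k) \<le> W_bias I (Trans t x u) + W_spike I (Trans t x u)"
  unfolding W_bias_plus_W_spike[OF assms(1)]
  using assms(2) by (auto intro!: Max.coboundedI[THEN order_trans[rotated]] simp del: edge_cost.simps)

text \<open>The spike weight of an edge is the extra cost of one particular demand, in which the whole
  budget is spent at a single time on power or on heat.\<close>

lemma spike_attained:
  assumes "e \<in> transitions I"
  obtains k \<xi> where "k \<in> {1..horizon I}" "\<xi> = spike_P I k \<or> \<xi> = spike_H I k"
    "edge_cost I e \<xi> = W_bias I e + W_spike I e"
proof -
  obtain t x u where e: "e = Trans t x u" "1 \<le> dur I x u" "{t..<t + dur I x u} \<subseteq> {1..horizon I}"
    using assms by (rule transition_cases)
  let ?f = "\<lambda>k. max (edge_cost I e (spike_P I k)) (edge_cost I e (spike_H I k))"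
  have "Max (?f ` {t..<t + dur I x u}) \<in> ?f ` {t..<t + dur I x u}"
    using e(2) by (intro Max_in) auto
  then obtain k where "k \<in> {t..<t + dur I x u}" "Max (?f ` {t..<t + dur I x u}) = ?f k"
    by blast
  then show thesis
    using that[of k "spike_P I k"] that[of k "spike_H I k"] W_bias_plus_W_spike[of t x u] assms e
    by (auto simp: max_def simp del: edge_cost.simps split: if_splits)
qed

lemma W_bias_finite:
  assumes "e \<in> transitions I" "W_spike I e < \<infinity>"
  shows "W_bias I e < \<infinity>"
proof -
  obtain t x u where e: "e = Trans t x u" "1 \<le> dur I x u"
    using assms(1) by (rule transition_cases)
  have "W_spike I e = \<infinity>" if "W_bias I e = \<infinity>"
    using W_bias_plus_W_spike[of t x u] assms(1) that unfolding e W_spike.simps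
    by (simp del: edge_cost.simps)
  then show ?thesis
    using assms(2) by (cases "W_bias I e") auto
qed

lemma W_spike_nonneg:
  assumes "e \<in> transitions I"
  shows "0 \<le> W_spike I e"
proof (cases "W_spike I e < \<infinity>")
  case True
  obtain k \<xi> where k: "\<xi> = spike_P I k \<or> \<xi> = spike_H I k"
      "edge_cost I e \<xi> = W_bias I e + W_spike I e"
    using assms by (rule spike_attained)
  obtain b where b: "W_bias I e = ereal b"
    using W_bias_finite[OF assms True] W_bias_not_MInf[of e] assms transitions_iff
    by (cases "W_bias I e") auto
  have "W_bias I e \<le> edge_cost I e \<xi>"
    unfolding W_bias_def
    using W_bias_finite[OF assms True] assms k(1) bias_le_spike
    by (intro edge_cost_mono) (auto simp: transitions_iff W_bias_def)
  then show ?thesis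
    unfolding k(2) b by (cases "W_spike I e") auto
qed auto

text \<open>If the demand at time \<open>k\<close> uses the fractions \<open>lP k\<close> and \<open>lH k\<close> of the budget, the chord bound
  charges each fraction with at most the spike weight of the edge that is active at time \<open>k\<close>.\<close>

lemma edge_cost_le_spike:
  assumes e: "e \<in> transitions I" and fin: "W_spike I e < \<infinity>" "edge_cost I e \<xi> < \<infinity>"
    and l: "\<And>k. k \<in> {1..horizon I} \<Longrightarrow> 0 \<le> lP k \<and> lP k \<le> 1 \<and> 0 \<le> lH k \<and> lH k \<le> 1"
    and le: "\<And>k. k \<in> {1..horizon I} \<Longrightarrow>
      fst \<xi> k \<le> fst (bias_demand I) k + lP k * (budget I / wgt_P I k) \<and>
      snd \<xi> k \<le> snd (bias_demand I) k + lH k * (budget I / wgt_H I k)"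
  shows "edge_cost I e \<xi> \<le> W_bias I e + ereal (load (\<lambda>k. lP k + lH k) e) * W_spike I e"
proof -
  obtain t x u where txu: "e = Trans t x u" "{t..<t + dur I x u} \<subseteq> {1..horizon I}"
    using e by (rule transition_cases)
  let ?K = "{t..<t + dur I x u}"
  define P where "P \<zeta> k = real_of_ereal (util_P I k (fst \<zeta> k - gen_P I x u))" for \<zeta> :: demand and k
  define H where "H \<zeta> k = real_of_ereal (util_H I k (snd \<zeta> k - gen_H I x u))" for \<zeta> :: demand and k
  have real: "edge_cost I e \<zeta> = ereal (op_cost I x u + (\<Sum>k\<in>?K. P \<zeta> k + H \<zeta> k))"
    if "edge_cost I e \<zeta> < \<infinity>" for \<zeta>
    using edge_cost_real[of t x u \<zeta>] e that by (simp only: txu P_def H_def)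
  have fin_util: "util_P I k (fst \<zeta> k - gen_P I x u) < \<infinity> \<and> util_H I k (snd \<zeta> k - gen_H I x u) < \<infinity>"
    if "edge_cost I e \<zeta> < \<infinity>" "k \<in> ?K" for \<zeta> k
    using that edge_cost_eq_PInf[of t x u \<zeta>] by (auto simp: txu simp del: edge_cost.simps)
  let ?b = "bias_demand I"
  have bias_fin: "edge_cost I e ?b < \<infinity>"
    using W_bias_finite[OF e fin(1)] by (simp add: W_bias_def)
  obtain d where d: "W_spike I e = ereal d"
    using fin(1) W_spike_nonneg[OF e] by (cases "W_spike I e") auto
  have spike_fin: "edge_cost I e (spike_P I k) < \<infinity>" "edge_cost I e (spike_H I k) < \<infinity>"
    if "k \<in> ?K" for k
    using spike_le[of t x u k] e that bias_fin d
    by (auto simp: txu W_bias_def simp del: edge_cost.simps W_spike.simps intro: le_less_trans)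
  \<comment> \<open>A spike at \<open>k\<close> changes a single term of the sum of stages, so this term grows by at most the
    spike weight of the whole edge.\<close>
  have dP: "P (spike_P I k) k - P ?b k \<le> d" if k: "k \<in> ?K" for k
  proof -
    have "P (spike_P I k) j - P ?b j + (H (spike_P I k) j - H ?b j) =
        (if k = j then P (spike_P I k) k - P ?b k else 0)" for j
      by (simp add: P_def H_def spike_P_def)
    then have "(\<Sum>j\<in>?K. P (spike_P I k) j + H (spike_P I k) j) - (\<Sum>j\<in>?K. P ?b j + H ?b j) =
        P (spike_P I k) k - P ?b k"
      using k by (simp flip: sum_subtractf add: add_diff_add)
    moreover have "edge_cost I e (spike_P I k) \<le> edge_cost I e ?b + ereal d"
      using spike_le(1)[of t x u k] e k unfolding txu(1)[symmetric] W_bias_def d by blast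
    ultimately show ?thesis
      using real[OF spike_fin(1)[OF k]] real[OF bias_fin] by simp
  qed
  have dH: "H (spike_H I k) k - H ?b k \<le> d" if k: "k \<in> ?K" for k
  proof -
    have "P (spike_H I k) j - P ?b j + (H (spike_H I k) j - H ?b j) =
        (if k = j then H (spike_H I k) k - H ?b k else 0)" for j
      by (simp add: P_def H_def spike_H_def)
    then have "(\<Sum>j\<in>?K. P (spike_H I k) j + H (spike_H I k) j) - (\<Sum>j\<in>?K. P ?b j + H ?b j) =
        H (spike_H I k) k - H ?b k"
      using k by (simp flip: sum_subtractf add: add_diff_add)
    moreover have "edge_cost I e (spike_H I k) \<le> edge_cost I e ?b + ereal d"
      using spike_le(2)[of t x u k] e k unfolding txu(1)[symmetric] W_bias_def d by blast
    ultimately show ?thesis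
      using real[OF spike_fin(2)[OF k]] real[OF bias_fin] by simp
  qed
  have stage: "P \<xi> k + H \<xi> k \<le> P ?b k + H ?b k + (lP k + lH k) * d" if k: "k \<in> ?K" for k
  proof -
    have kT: "k \<in> {1..horizon I}"
      using k txu by auto
    have "P \<xi> k \<le> P ?b k + lP k * (P (spike_P I k) k - P ?b k)"
      unfolding P_def using utility_cost_chord[OF util_costs(1)[OF kT],
        of "fst ?b k - gen_P I x u" "budget I / wgt_P I k" "fst \<xi> k - gen_P I x u" "lP k"]
        fin_util[OF bias_fin k] fin_util[OF spike_fin(1)[OF k] k] fin_util[OF fin(2) k] l[OF kT] le[OF kT]
      by (simp add: spike_P_def algebra_simps)
    moreover have "H \<xi> k \<le> H ?b k + lH k * (H (spike_H I k) k - H ?b k)"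
      unfolding H_def using utility_cost_chord[OF util_costs(2)[OF kT],
        of "snd ?b k - gen_H I x u" "budget I / wgt_H I k" "snd \<xi> k - gen_H I x u" "lH k"]
        fin_util[OF bias_fin k] fin_util[OF spike_fin(2)[OF k] k] fin_util[OF fin(2) k] l[OF kT] le[OF kT]
      by (simp add: spike_H_def algebra_simps)
    moreover have "lP k * (P (spike_P I k) k - P ?b k) \<le> lP k * d"
      "lH k * (H (spike_H I k) k - H ?b k) \<le> lH k * d"
      using dP[OF k] dH[OF k] l[OF kT] by (auto intro: mult_left_mono)
    ultimately show ?thesis
      by (simp add: distrib_right)
  qed
  have "(\<Sum>k\<in>?K. P \<xi> k + H \<xi> k) \<le> (\<Sum>k\<in>?K. P ?b k + H ?b k + (lP k + lH k) * d)"
    by (rule sum_mono) (rule stage)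
  also have "\<dots> = (\<Sum>k\<in>?K. P ?b k + H ?b k) + load (\<lambda>k. lP k + lH k) e * d"
    by (simp only: txu load.simps sum.distrib sum_distrib_right distrib_right)
  finally show ?thesis
    using real[OF fin(2)] real[OF bias_fin] by (simp add: W_bias_def d)
qed

lemma uncertainty_setI:
  assumes "\<And>k. k \<in> {1..horizon I} \<Longrightarrow> fst \<xi> k = nom_P I k + a k + b k \<and> snd \<xi> k = nom_H I k + a' k + b' k"
    and "(\<Sum>k = 1..horizon I. \<bar>wgt_P I k * a k\<bar> + \<bar>wgt_H I k * a' k\<bar>) \<le> budget I"
    and "\<And>k. k \<in> {1..horizon I} \<Longrightarrow> \<bar>b k\<bar> \<le> dev_P I k \<and> \<bar>b' k\<bar> \<le> dev_H I k"
  shows "\<xi> \<in> uncertainty_set I"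
  unfolding uncertainty_set_def case_prod_unfold mem_Collect_eq
  by (rule exI[of _ a], rule exI[of _ b], rule exI[of _ a'], rule exI[of _ b'])
    (intro conjI ballI; use assms in blast)

lemma dev_nonneg: "k \<in> {1..horizon I} \<Longrightarrow> 0 \<le> dev_P I k \<and> 0 \<le> dev_H I k"
  using model by (auto simp: mgt_model_def)

lemma bias_in_uncertainty_set: "bias_demand I \<in> uncertainty_set I"
  by (rule uncertainty_setI[where a = "\<lambda>_. 0" and a' = "\<lambda>_. 0" and b = "dev_P I" and b' = "dev_H I"])
    (use dev_nonneg budget_nonneg in \<open>auto simp: bias_demand_def\<close>)

lemma spike_in_uncertainty_set:
  assumes "k \<in> {1..horizon I}"
  shows "spike_P I k \<in> uncertainty_set I" "spike_H I k \<in> uncertainty_set I"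
proof -
  have *: "\<bar>w * (if k = j then budget I / w' j else 0)\<bar> = (if k = j then \<bar>w * (budget I / w' k)\<bar> else 0)"
    for w j and w' :: "nat \<Rightarrow> real"
    by simp
  show "spike_P I k \<in> uncertainty_set I"
    by (rule uncertainty_setI[where a = "\<lambda>j. if k = j then budget I / wgt_P I j else 0"
          and a' = "\<lambda>_. 0" and b = "dev_P I" and b' = "dev_H I"])
      (use assms dev_nonneg budget_nonneg wgt_pos[OF assms] in
        \<open>auto simp: spike_P_def bias_demand_def *\<close>)
  show "spike_H I k \<in> uncertainty_set I"
    by (rule uncertainty_setI[where a' = "\<lambda>j. if k = j then budget I / wgt_H I j else 0"
          and a = "\<lambda>_. 0" and b = "dev_P I" and b' = "dev_H I"])
      (use assms dev_nonneg budget_nonneg wgt_pos[OF assms] in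
        \<open>auto simp: spike_H_def bias_demand_def *\<close>)
qed

text \<open>The budget fractions of a demand in the uncertainty set sum to at most one.  For
  a zero budget the quotients below are zero by the convention for division, which is right because
  then nothing is spent.\<close>

lemma uncertainty_set_fractions:
  assumes "\<xi> \<in> uncertainty_set I"
  obtains lP lH where
    "\<forall>k\<in>{1..horizon I}. 0 \<le> lP k \<and> lP k \<le> 1 \<and> 0 \<le> lH k \<and> lH k \<le> 1"
    "\<forall>k\<in>{1..horizon I}.
      fst \<xi> k \<le> fst (bias_demand I) k + lP k * (budget I / wgt_P I k) \<and>
      snd \<xi> k \<le> snd (bias_demand I) k + lH k * (budget I / wgt_H I k)"
    "(\<Sum>k = 1..<horizon I. lP k + lH k) \<le> 1"
proof -
  let ?T = "{1..horizon I}"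
  have "\<exists>a b a' b'.
      (\<forall>k\<in>?T. fst \<xi> k = nom_P I k + a k + b k \<and> snd \<xi> k = nom_H I k + a' k + b' k) \<and>
      (\<Sum>k\<in>?T. \<bar>wgt_P I k * a k\<bar> + \<bar>wgt_H I k * a' k\<bar>) \<le> budget I \<and>
      (\<forall>k\<in>?T. \<bar>b k\<bar> \<le> dev_P I k \<and> \<bar>b' k\<bar> \<le> dev_H I k)"
    using assms unfolding uncertainty_set_def case_prod_unfold mem_Collect_eq .
  then obtain a b a' b' where
    eq: "\<And>k. k \<in> ?T \<Longrightarrow> fst \<xi> k = nom_P I k + a k + b k \<and> snd \<xi> k = nom_H I k + a' k + b' k" and
    sum: "(\<Sum>k\<in>?T. \<bar>wgt_P I k * a k\<bar> + \<bar>wgt_H I k * a' k\<bar>) \<le> budget I" and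
    dev: "\<And>k. k \<in> ?T \<Longrightarrow> \<bar>b k\<bar> \<le> dev_P I k \<and> \<bar>b' k\<bar> \<le> dev_H I k"
    by blast
  define lP where "lP k = \<bar>wgt_P I k * a k\<bar> / budget I" for k
  define lH where "lH k = \<bar>wgt_H I k * a' k\<bar> / budget I" for k
  have nonneg: "0 \<le> lP k" "0 \<le> lH k" for k
    using budget_nonneg by (simp_all add: lP_def lH_def)
  have le1: "(\<Sum>k\<in>?T. lP k + lH k) \<le> 1"
    using sum budget_nonneg
    by (cases "budget I = 0") (simp_all add: lP_def lH_def flip: add_divide_distrib sum_divide_distrib)
  have summand: "\<bar>wgt_P I k * a k\<bar> \<le> budget I \<and> \<bar>wgt_H I k * a' k\<bar> \<le> budget I" if "k \<in> ?T" for k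
    using member_le_sum[OF that, of "\<lambda>k. \<bar>wgt_P I k * a k\<bar> + \<bar>wgt_H I k * a' k\<bar>"] sum
    by (simp, linarith)
  have a: "lP k * (budget I / wgt_P I k) = \<bar>a k\<bar>" "lH k * (budget I / wgt_H I k) = \<bar>a' k\<bar>"
    if "k \<in> ?T" for k
    using wgt_pos[OF that] summand[OF that] by (auto simp: lP_def lH_def abs_mult mult_le_0_iff)
  have "lP k + lH k \<le> 1" if "k \<in> ?T" for k
    using member_le_sum[OF that, of "\<lambda>k. lP k + lH k"] nonneg le1 by (simp add: add_nonneg_nonneg)
  then have "0 \<le> lP k \<and> lP k \<le> 1 \<and> 0 \<le> lH k \<and> lH k \<le> 1" if "k \<in> ?T" for k
    using nonneg[of k] that by (smt (verit))
  moreover have "fst \<xi> k \<le> fst (bias_demand I) k + lP k * (budget I / wgt_P I k) \<and>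
      snd \<xi> k \<le> snd (bias_demand I) k + lH k * (budget I / wgt_H I k)" if "k \<in> ?T" for k
    using eq[OF that] dev[OF that] unfolding a[OF that] bias_demand_def by (auto simp: abs_le_iff)
  moreover have "(\<Sum>k = 1..<horizon I. lP k + lH k) \<le> (\<Sum>k\<in>?T. lP k + lH k)"
    by (rule sum_mono2) (auto intro: add_nonneg_nonneg nonneg)
  ultimately show thesis
    using le1 by (intro that[of lP lH] ballI) auto
qed

lemma W_spike_le_path_spike: "e \<in> set p \<Longrightarrow> is_Trans e \<Longrightarrow> W_spike I e \<le> path_spike I p"
  unfolding path_spike_def by (rule Max_ge) auto

lemma path_spike_attained:
  assumes "well_posed I" "p \<in> st_paths I"
  obtains e where "e \<in> set p" "e \<in> transitions I" "path_spike I p = W_spike I e"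
proof -
  have "path_spike I p \<in> W_spike I ` {e \<in> set p. is_Trans e}"
    unfolding path_spike_def using path_has_transition[OF assms] by (intro Max_in) auto
  then show thesis
    using that walk_edges[of Source p Terminal] assms(2)
    by (auto simp: st_paths_iff transitions_iff)
qed

definition robust_cost :: "('x, 'u) edge list \<Rightarrow> ereal" where
  "robust_cost p = (SUP \<xi>\<in>uncertainty_set I. \<Sum>e\<leftarrow>p. edge_cost I e \<xi>)"

text \<open>The spike that attains the largest spike weight of the path is itself a possible demand.
  It raises the cost of one edge by this weight and, by monotonicity, lowers no other edge cost.  If
  an edge is unaffordable already at the bias demand, monotonicity may fail, but then the bias demand
  itself makes the robust cost infinite.\<close>

lemma robust_cost_ge:
  assumes wp: "well_posed I" and p: "p \<in> st_paths I"
  shows "path_value I p \<le> robust_cost p"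
proof -
  have pE: "set p \<subseteq> E"
    using p walk_edges by (simp add: st_paths_iff)
  show ?thesis
  proof (cases "(\<Sum>e\<leftarrow>p. W_bias I e) = \<infinity>")
    case True
    then have "(\<Sum>e\<leftarrow>p. edge_cost I e (bias_demand I)) = \<infinity>"
      by (simp add: W_bias_def)
    then have "robust_cost p = \<infinity>"
      using SUP_upper[OF bias_in_uncertainty_set, of "\<lambda>\<xi>. \<Sum>e\<leftarrow>p. edge_cost I e \<xi>"]
      by (simp add: robust_cost_def)
    then show ?thesis
      by simp
  next
    case False
    then have fin: "edge_cost I e (bias_demand I) < \<infinity>" if "e \<in> set p" for e
      using that by (auto simp: sum_list_eq_PInf W_bias_def)
    obtain e where e: "e \<in> set p" "e \<in> transitions I" "path_spike I p = W_spike I e"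
      using wp p by (rule path_spike_attained)
    obtain k \<xi> where k: "k \<in> {1..horizon I}" "\<xi> = spike_P I k \<or> \<xi> = spike_H I k"
        "edge_cost I e \<xi> = W_bias I e + W_spike I e"
      using e(2) by (rule spike_attained)
    have le: "W_bias I e' \<le> edge_cost I e' \<xi>" if "e' \<in> set p" for e'
      unfolding W_bias_def using that pE k(2) fin[OF that] bias_le_spike
      by (intro edge_cost_mono) auto
    obtain p1 p2 where split: "p = p1 @ e # p2"
      using split_list[OF e(1)] by blast
    have "path_value I p = (\<Sum>e'\<leftarrow>p1. W_bias I e') + (W_bias I e + W_spike I e) + (\<Sum>e'\<leftarrow>p2. W_bias I e')"
      unfolding path_value_def e(3) by (simp add: split ac_simps)
    also have "\<dots> \<le> (\<Sum>e'\<leftarrow>p1. edge_cost I e' \<xi>) + edge_cost I e \<xi> + (\<Sum>e'\<leftarrow>p2. edge_cost I e' \<xi>)"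
      unfolding k(3)[symmetric] using le by (intro add_mono sum_list_mono order_refl) (auto simp: split)
    also have "\<dots> = (\<Sum>e'\<leftarrow>p. edge_cost I e' \<xi>)"
      by (simp add: split add.assoc)
    also have "\<dots> \<le> robust_cost p"
      unfolding robust_cost_def using k spike_in_uncertainty_set by (intro SUP_upper) auto
    finally show ?thesis .
  qed
qed

text \<open>By the chord bound, each edge adds at most its share of the budget times its spike weight to
  the bias cost, and the shares of all edges of a path sum to at most one.\<close>

lemma robust_cost_le:
  assumes wp: "well_posed I" and nhi: "no_hidden_infinity I" and p: "p \<in> st_paths I"
  shows "robust_cost p \<le> path_value I p"
proof -
  have pE: "set p \<subseteq> E"
    using p walk_edges by (simp add: st_paths_iff)
  have trans: "e \<in> transitions I" if "e \<in> set p" "is_Trans e" for e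
    using that pE by (auto simp: transitions_iff)
  obtain e0 where e0: "e0 \<in> transitions I" "path_spike I p = W_spike I e0"
    using wp p by (rule path_spike_attained)
  show ?thesis
  proof (cases "path_spike I p < \<infinity>")
    case False
    then show ?thesis
      by (simp add: path_value_def)
  next
    case True
    have "0 \<le> path_spike I p"
      using W_spike_nonneg[OF e0(1)] by (simp add: e0(2))
    with True obtain d where d: "path_spike I p = ereal d" "0 \<le> d"
      by (cases "path_spike I p") auto
    have "(\<Sum>e\<leftarrow>p. edge_cost I e \<xi>) \<le> path_value I p" if \<xi>: "\<xi> \<in> uncertainty_set I" for \<xi>
    proof -
      obtain lP lH where l:
        "\<forall>k\<in>{1..horizon I}. 0 \<le> lP k \<and> lP k \<le> 1 \<and> 0 \<le> lH k \<and> lH k \<le> 1"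
        "\<forall>k\<in>{1..horizon I}.
          fst \<xi> k \<le> fst (bias_demand I) k + lP k * (budget I / wgt_P I k) \<and>
          snd \<xi> k \<le> snd (bias_demand I) k + lH k * (budget I / wgt_H I k)"
        and sum: "(\<Sum>k = 1..<horizon I. lP k + lH k) \<le> 1"
        using \<xi> by (rule uncertainty_set_fractions)
      let ?L = "load (\<lambda>k. lP k + lH k)"
      have edge: "edge_cost I e \<xi> \<le> W_bias I e + ereal (?L e * d)" if e: "e \<in> set p" for e
      proof (cases "is_Trans e")
        case False
        then show ?thesis
          by (cases e) (auto simp: W_bias_def)
      next
        case True
        note le = W_spike_le_path_spike[OF e True]
        then have fin: "W_spike I e < \<infinity>"
          using \<open>path_spike I p < \<infinity>\<close> by (rule le_less_trans)
        then have "edge_cost I e \<xi> < \<infinity>"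
          using nhi \<xi> trans[OF e True] unfolding no_hidden_infinity_def by blast
        then have "edge_cost I e \<xi> \<le> W_bias I e + ereal (?L e) * W_spike I e"
          using trans[OF e True] fin l by (intro edge_cost_le_spike) auto
        also have "0 \<le> ?L e"
          using trans[OF e True]
          by (rule transition_cases) (auto intro!: sum_nonneg add_nonneg_nonneg simp: l(1)[rule_format] subset_iff)
        then have "W_bias I e + ereal (?L e) * W_spike I e \<le> W_bias I e + ereal (?L e) * path_spike I p"
          using le by (intro add_mono ereal_mult_left_mono) auto
        finally show ?thesis
          by (simp add: d)
      qed
      have sums: "(\<Sum>e\<leftarrow>q. ereal (?L e * d)) = ereal ((\<Sum>e\<leftarrow>q. ?L e) * d)" for q
        by (induction q) (auto simp: distrib_right zero_ereal_def)
      have "(\<Sum>e\<leftarrow>p. edge_cost I e \<xi>) \<le> (\<Sum>e\<leftarrow>p. W_bias I e + ereal (?L e * d))"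
        using edge by (rule sum_list_mono)
      also have "\<dots> = (\<Sum>e\<leftarrow>p. W_bias I e) + ereal ((\<Sum>e\<leftarrow>p. ?L e) * d)"
        by (simp only: sum_list_addf sums)
      also have "\<dots> \<le> path_value I p"
        unfolding path_value_def d load_path[OF p]
        using mult_right_mono[OF sum d(2)] by (intro add_left_mono) simp
      finally show ?thesis .
    qed
    then show ?thesis
      unfolding robust_cost_def by (rule SUP_least)
  qed
qed

lemma robust_cost_eq_path_value:
  "well_posed I \<Longrightarrow> no_hidden_infinity I \<Longrightarrow> p \<in> st_paths I \<Longrightarrow> robust_cost p = path_value I p"
  using robust_cost_ge robust_cost_le by (blast intro: antisym)

lemma V_star_eq:
  assumes "well_posed I" "no_hidden_infinity I"
  shows "V_star I = (INF p\<in>st_paths I. path_value I p)"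
  unfolding V_star_def using robust_cost_eq_path_value[OF assms]
  by (intro INF_cong refl) (simp add: robust_cost_def)

section \<open>The grid of thresholds\<close>

lemma finite_spikes_Min_Max:
  assumes "well_posed I"
  shows "finite (finite_spikes I)" "W_min I \<in> finite_spikes I" "W_max I \<in> finite_spikes I"
    "\<And>s. s \<in> finite_spikes I \<Longrightarrow> W_min I \<le> s \<and> s \<le> W_max I"
proof -
  have "finite_spikes I \<subseteq> W_spike I ` transitions I"
    by (auto simp: finite_spikes_def)
  then show fin: "finite (finite_spikes I)"
    using finite_transitions by (meson finite_imageI finite_subset)
  have ne: "finite_spikes I \<noteq> {}"
    using assms by (simp add: well_posed_def)
  show "W_min I \<in> finite_spikes I" "W_max I \<in> finite_spikes I"
    using fin ne by (simp_all add: W_min_def W_max_def Min_in Max_in)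
  show "W_min I \<le> s \<and> s \<le> W_max I" if "s \<in> finite_spikes I" for s
    using fin that by (simp add: W_min_def W_max_def)
qed

lemma finite_spikes_real:
  assumes "s \<in> finite_spikes I"
  obtains r where "s = ereal r" "0 \<le> r"
proof -
  have "0 \<le> s" "s < \<infinity>"
    using assms W_spike_nonneg by (auto simp: finite_spikes_def)
  then show thesis
    using that by (cases s) auto
qed

lemma W_min_W_max_real:
  assumes "well_posed I"
  obtains m M where "W_min I = ereal m" "W_max I = ereal M" "m \<le> M"
proof -
  obtain m M where mM: "W_min I = ereal m" "W_max I = ereal M"
    using finite_spikes_Min_Max(2,3)[OF assms] by (metis finite_spikes_real)
  moreover have "W_min I \<le> W_max I"
    using finite_spikes_Min_Max[OF assms] by blast
  ultimately show thesis
    using that by simp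
qed

lemma Thresh_finite_value:
  assumes "well_posed I" "\<alpha> \<in> Thresh I \<epsilon>"
  shows "\<alpha> < \<infinity>"
proof -
  obtain m M where "W_min I = ereal m" "W_max I = ereal M"
    using assms(1) by (rule W_min_W_max_real)
  then show ?thesis
    using assms(2) by (auto simp: Thresh_def)
qed

text \<open>Rounding a spike weight up to the grid costs at most \<open>\<epsilon>\<close>; if the rounded value
  exceeds the largest spike weight, the latter is itself a threshold.\<close>

lemma Thresh_rounds_up:
  assumes wp: "well_posed I" and "0 < \<epsilon>" and s: "s \<in> finite_spikes I"
  obtains \<alpha> where "\<alpha> \<in> Thresh I \<epsilon>" "s \<le> \<alpha>" "\<alpha> \<le> s + ereal \<epsilon>"
proof -
  obtain m M where mM: "W_min I = ereal m" "W_max I = ereal M"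
    using wp by (rule W_min_W_max_real)
  obtain r where r: "s = ereal r" "m \<le> r" "r \<le> M"
    using finite_spikes_real[OF s] finite_spikes_Min_Max(4)[OF wp s] mM by (metis ereal_less_eq(3))
  \<comment> \<open>the number of the first grid point above \<open>s\<close>\<close>
  define k where "k = nat \<lceil>(r - m) / \<epsilon>\<rceil>"
  have "real k = of_int \<lceil>(r - m) / \<epsilon>\<rceil>"
    using r(2) \<open>0 < \<epsilon>\<close> by (simp add: k_def)
  then have "(r - m) / \<epsilon> \<le> real k" "real k < (r - m) / \<epsilon> + 1"
    by linarith+
  then have k: "r \<le> m + real k * \<epsilon>" "m + real k * \<epsilon> \<le> r + \<epsilon>"
    using \<open>0 < \<epsilon>\<close> by (simp_all add: field_simps)
  show thesis
  proof (cases "m + real k * \<epsilon> \<le> M")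
    case True
    then show ?thesis
      using k by (intro that[of "ereal (m + real k * \<epsilon>)"]) (auto simp: Thresh_def mM r)
  next
    case False
    then show ?thesis
      using k r by (intro that[of "ereal M"]) (auto simp: Thresh_def mM)
  qed
qed

text \<open>An infinite bias weight forces an infinite spike weight, so every edge admitted by a finite
  threshold has a finite weight.\<close>

lemma threshold_weight_finite:
  assumes "e \<in> E" "\<alpha> < \<infinity>"
  shows "threshold_weight I \<alpha> e < \<infinity> \<longleftrightarrow> W_spike I e \<le> \<alpha>"
proof (cases "is_Trans e")
  case True
  have "W_bias I e < \<infinity>" if "W_spike I e \<le> \<alpha>"
    using le_less_trans[OF that assms(2)] True assms(1)
    by (intro W_bias_finite) (simp add: transitions_iff)
  then show ?thesis
    using True by (auto simp: threshold_weight_def)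
next
  case False
  then show ?thesis
    by (cases e) (auto simp: threshold_weight_def W_bias_def)
qed

lemma threshold_weight_not_MInf: "e \<in> E \<Longrightarrow> threshold_weight I \<alpha> e \<noteq> -\<infinity>"
  by (simp add: threshold_weight_def W_bias_not_MInf)

lemma path_weight_finite:
  assumes "set p \<subseteq> E" "\<alpha> < \<infinity>"
  shows "path_weight I \<alpha> p < \<infinity> \<longleftrightarrow> (\<forall>e\<in>set p. W_spike I e \<le> \<alpha>)"
proof -
  have "path_weight I \<alpha> p < \<infinity> \<longleftrightarrow> (\<forall>e\<in>set p. threshold_weight I \<alpha> e < \<infinity>)"
    using sum_list_eq_PInf[of "threshold_weight I \<alpha>" p] unfolding path_weight_def
    by (auto simp: less_top[symmetric] top_ereal_def)
  then show ?thesis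
    using assms threshold_weight_finite by blast
qed

lemma path_weight_eq_bias:
  assumes "\<forall>e\<in>set p. W_spike I e \<le> \<alpha>"
  shows "path_weight I \<alpha> p = (\<Sum>e\<leftarrow>p. W_bias I e)"
  unfolding path_weight_def using assms
  by (intro arg_cong[where f = sum_list] map_cong refl) (auto simp: threshold_weight_def)

lemma shortest_path_exists: "well_posed I \<Longrightarrow> \<exists>p. shortest_path I \<alpha> p"
proof -
  assume "well_posed I"
  then have ne: "st_paths I \<noteq> {}"
    by (simp add: well_posed_def)
  define w where "w = Min (path_weight I \<alpha> ` st_paths I)"
  define A where "A = {p \<in> st_paths I. path_weight I \<alpha> p = w}"
  have "w \<in> path_weight I \<alpha> ` st_paths I"
    unfolding w_def using ne finite_st_paths by (intro Min_in) auto
  then have A: "A \<noteq> {}" "finite A"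
    using finite_st_paths by (auto simp: A_def)
  then have "Min (path_spike I ` A) \<in> path_spike I ` A"
    by (intro Min_in) auto
  then obtain p where p: "p \<in> A" "path_spike I p = Min (path_spike I ` A)"
    by force
  have "path_spike I p \<le> path_spike I q" if "q \<in> A" for q
    unfolding p(2) using A that by (intro Min_le) auto
  moreover have "w \<le> path_weight I \<alpha> q" if "q \<in> st_paths I" for q
    unfolding w_def using finite_st_paths that by (intro Min_le) auto
  ultimately have "shortest_path I \<alpha> p"
    using p(1) unfolding shortest_path_def A_def by (metis (mono_tags, lifting) mem_Collect_eq order_le_less)
  then show ?thesis ..
qed

lemma finite_Thresh:
  assumes "well_posed I" "0 < \<epsilon>"
  shows "finite (Thresh I \<epsilon>)"
proof -
  obtain m M where mM: "W_min I = ereal m" "W_max I = ereal M"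
    using assms(1) by (rule W_min_W_max_real)
  have "k \<le> nat \<lfloor>(M - m) / \<epsilon>\<rfloor>" if "m + real k * \<epsilon> \<le> M" for k
  proof -
    have "real k \<le> (M - m) / \<epsilon>"
      using that assms(2) by (simp add: field_simps)
    then show ?thesis
      by (simp add: le_nat_floor)
  qed
  then have "Thresh I \<epsilon> \<subseteq> insert (ereal M) ((\<lambda>k. ereal (m + real k * \<epsilon>)) ` {..nat \<lfloor>(M - m) / \<epsilon>\<rfloor>})"
    by (auto simp: Thresh_def mM)
  then show ?thesis
    by (rule finite_subset) simp
qed

lemma algorithm_A_exists:
  assumes "well_posed I" "0 < \<epsilon>"
  shows "\<exists>v p. algorithm_A I (Thresh I \<epsilon>) v p"
proof -
  obtain V where V: "\<And>\<alpha>. shortest_path I \<alpha> (V \<alpha>)"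
    using shortest_path_exists[OF assms(1)] by metis
  have "Min ((\<lambda>\<beta>. path_value I (V \<beta>)) ` Thresh I \<epsilon>) \<in> (\<lambda>\<beta>. path_value I (V \<beta>)) ` Thresh I \<epsilon>"
    using finite_Thresh[OF assms] by (intro Min_in) (auto simp: Thresh_def)
  then obtain \<gamma> where \<gamma>: "\<gamma> \<in> Thresh I \<epsilon>"
      "Min ((\<lambda>\<beta>. path_value I (V \<beta>)) ` Thresh I \<epsilon>) = path_value I (V \<gamma>)"
    by blast
  then have "path_value I (V \<gamma>) \<le> path_value I (V \<beta>)" if "\<beta> \<in> Thresh I \<epsilon>" for \<beta>
    using finite_Thresh[OF assms] that by (metis Min_le finite_imageI imageI)
  then show ?thesis
    unfolding algorithm_A_def using V \<gamma>(1) by blast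
qed

text \<open>A threshold just above the spike weight of a path \<open>q\<close> admits \<open>q\<close>.  The shortest path for that
  threshold has no larger bias weight than \<open>q\<close>, and its spike weight is at most the threshold.\<close>

lemma shortest_path_value_le:
  assumes wp: "well_posed I" and sp: "shortest_path I \<alpha> p" and \<alpha>: "\<alpha> < \<infinity>"
    and q: "q \<in> st_paths I" "path_spike I q \<le> \<alpha>"
  shows "path_value I p \<le> (\<Sum>e\<leftarrow>q. W_bias I e) + \<alpha>"
proof -
  have p: "p \<in> st_paths I"
    using sp by (simp add: shortest_path_def)
  have E: "set p \<subseteq> E" "set q \<subseteq> E"
    using p q walk_edges by (auto simp: st_paths_iff)
  have spikes: "\<forall>e\<in>set q. W_spike I e \<le> \<alpha>"
  proof
    fix e assume e: "e \<in> set q"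
    show "W_spike I e \<le> \<alpha>"
    proof (cases "is_Trans e")
      case True
      then show ?thesis
        using W_spike_le_path_spike[OF e] q(2) by (blast intro: order_trans)
    next
      case False
      then show ?thesis
        by (cases e) auto
    qed
  qed
  then have "path_weight I \<alpha> q < \<infinity>"
    using path_weight_finite E(2) \<alpha> by blast
  moreover have le: "path_weight I \<alpha> p \<le> path_weight I \<alpha> q"
    using sp q(1) unfolding shortest_path_def by (auto simp: order.order_iff_strict)
  ultimately have "path_weight I \<alpha> p < \<infinity>"
    by (rule le_less_trans[rotated])
  then have p_spikes: "\<forall>e\<in>set p. W_spike I e \<le> \<alpha>"
    using path_weight_finite E(1) \<alpha> by blast
  obtain e where e: "e \<in> set p" "path_spike I p = W_spike I e"
    using wp p by (rule path_spike_attained)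
  have "(\<Sum>e\<leftarrow>p. W_bias I e) \<le> (\<Sum>e\<leftarrow>q. W_bias I e)"
    using le path_weight_eq_bias[OF spikes] path_weight_eq_bias[OF p_spikes] by simp
  then show ?thesis
    unfolding path_value_def using e p_spikes by (intro add_mono) auto
qed

lemma algorithm_A_bounds:
  assumes wp: "well_posed I" and nhi: "no_hidden_infinity I" and \<epsilon>: "0 < \<epsilon>"
    and alg: "algorithm_A I (Thresh I \<epsilon>) v p"
  shows "V_star I \<le> v" "v \<le> V_star I + ereal \<epsilon>"
proof -
  obtain V \<gamma> where V: "\<And>\<alpha>. \<alpha> \<in> Thresh I \<epsilon> \<Longrightarrow> shortest_path I \<alpha> (V \<alpha>)"
    and \<gamma>: "\<gamma> \<in> Thresh I \<epsilon>" "v = path_value I (V \<gamma>)"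
    and v: "\<And>\<beta>. \<beta> \<in> Thresh I \<epsilon> \<Longrightarrow> v \<le> path_value I (V \<beta>)"
    using alg unfolding algorithm_A_def by blast
  show "V_star I \<le> v"
    unfolding V_star_eq[OF wp nhi] \<gamma>(2)
    using V[OF \<gamma>(1)] by (intro INF_lower) (simp add: shortest_path_def)
  have "v - ereal \<epsilon> \<le> path_value I q" if q: "q \<in> st_paths I" for q
  proof (cases "path_spike I q < \<infinity>")
    case False
    then show ?thesis
      by (simp add: path_value_def)
  next
    case True
    then have "path_spike I q \<in> finite_spikes I"
      using path_spike_attained[OF wp q] by (force simp: finite_spikes_def)
    then obtain \<alpha> where \<alpha>: "\<alpha> \<in> Thresh I \<epsilon>" "path_spike I q \<le> \<alpha>" "\<alpha> \<le> path_spike I q + ereal \<epsilon>"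
      using Thresh_rounds_up[OF wp \<epsilon>] by metis
    have "v \<le> path_value I (V \<alpha>)"
      using \<alpha>(1) by (rule v)
    also have "\<dots> \<le> (\<Sum>e\<leftarrow>q. W_bias I e) + \<alpha>"
      using shortest_path_value_le[OF wp V[OF \<alpha>(1)] Thresh_finite_value[OF wp \<alpha>(1)] q \<alpha>(2)] .
    also have "\<dots> \<le> path_value I q + ereal \<epsilon>"
      using \<alpha>(3) by (simp add: path_value_def add.assoc add_left_mono)
    finally show ?thesis
      by (simp add: ereal_minus_le)
  qed
  then have "v - ereal \<epsilon> \<le> V_star I"
    unfolding V_star_eq[OF wp nhi] by (rule INF_greatest)
  then show "v \<le> V_star I + ereal \<epsilon>"
    by (simp add: ereal_minus_le)
qed

section \<open>Dynamic programming\<close>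

text \<open>The supremum gives the empty walk the value \<open>-\<infinity>\<close>, with which the program starts.\<close>

definition walk_spike :: "('x, 'u) edge list \<Rightarrow> ereal" where
  "walk_spike p = (SUP e\<in>set p. W_spike I e)"

lemma path_spike_eq:
  assumes "well_posed I" "p \<in> st_paths I"
  shows "path_spike I p = walk_spike p"
proof (rule antisym)
  show "path_spike I p \<le> walk_spike p"
    using path_spike_attained[OF assms] unfolding walk_spike_def by (metis SUP_upper)
  show "walk_spike p \<le> path_spike I p"
    unfolding walk_spike_def
  proof (rule SUP_least)
    fix e assume e: "e \<in> set p"
    show "W_spike I e \<le> path_spike I p"
    proof (cases "is_Trans e")
      case True
      with e show ?thesis
        by (rule W_spike_le_path_spike)
    next
      case False
      then show ?thesis
        by (cases e) auto
    qed
  qed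
qed

definition walk_label :: "ereal \<Rightarrow> ('x, 'u) edge list \<Rightarrow> ('x, 'u) label" where
  "walk_label \<alpha> p = (path_weight I \<alpha> p, \<Sum>e\<leftarrow>p. W_bias I e, walk_spike p, rev p)"

definition entry :: "('x, 'u) edge \<Rightarrow> ('x, 'u) entry" where
  "entry e = (e, W_bias I e, W_spike I e)"

lemma fst_entry [simp]: "fst (entry e) = e"
  by (simp add: entry_def)

lemma path_weight_snoc: "path_weight I \<alpha> (p @ [e]) = path_weight I \<alpha> p + threshold_weight I \<alpha> e"
  by (simp add: path_weight_def)

lemma walk_spike_snoc: "walk_spike (p @ [e]) = max (walk_spike p) (W_spike I e)"
  by (simp add: walk_spike_def sup_max max.commute)

lemma extend_walk_label: "extend \<alpha> (entry e) (walk_label \<alpha> p) = walk_label \<alpha> (p @ [e])"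
  by (simp add: walk_label_def entry_def path_weight_snoc walk_spike_snoc threshold_weight_def)

definition no_worse :: "ereal \<Rightarrow> ('x, 'u) edge list \<Rightarrow> ('x, 'u) edge list \<Rightarrow> bool" where
  "no_worse \<alpha> p q \<longleftrightarrow> path_weight I \<alpha> p < path_weight I \<alpha> q \<or>
     path_weight I \<alpha> p = path_weight I \<alpha> q \<and> walk_spike p \<le> walk_spike q"

lemma better_iff: "better (walk_label \<alpha> p) (Some (walk_label \<alpha> q)) \<longleftrightarrow> \<not> no_worse \<alpha> q p"
  by (auto simp: walk_label_def no_worse_def)

lemma no_worse_trans: "no_worse \<alpha> p q \<Longrightarrow> no_worse \<alpha> q r \<Longrightarrow> no_worse \<alpha> p r"
  by (auto simp: no_worse_def)

lemma no_worse_refl: "no_worse \<alpha> p p"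
  by (simp add: no_worse_def)

lemma no_worse_total: "\<not> no_worse \<alpha> p q \<Longrightarrow> no_worse \<alpha> q p"
  by (auto simp: no_worse_def)

text \<open>In general a lexicographic order of sums and maxima is not preserved when an edge of infinite
  weight is appended: the sums become equal, and the maxima of the prefixes decide after all.  Here
  a prefix of finite weight has only spikes up to \<open>\<alpha>\<close>, and an edge of infinite weight has a spike
  above \<open>\<alpha>\<close>, which then determines the maximum.  This is why the principle of optimality holds.\<close>

lemma no_worse_snoc:
  assumes pq: "no_worse \<alpha> p q" and E: "set p \<subseteq> E" "set q \<subseteq> E" "e \<in> E" and \<alpha>: "\<alpha> < \<infinity>"
  shows "no_worse \<alpha> (p @ [e]) (q @ [e])"
proof (cases "W_spike I e \<le> \<alpha>")
  case True
  then have "threshold_weight I \<alpha> e < \<infinity>"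
    using threshold_weight_finite[OF E(3) \<alpha>] by blast
  then obtain b where b: "threshold_weight I \<alpha> e = ereal b"
    using threshold_weight_not_MInf[OF E(3), of \<alpha>] by (cases "threshold_weight I \<alpha> e") auto
  have "x + ereal b < y + ereal b" if "x < y" for x y
    using that by (cases x; cases y) auto
  then show ?thesis
    using pq by (auto simp: no_worse_def path_weight_snoc walk_spike_snoc b le_max_iff_disj)
next
  case False
  then have "threshold_weight I \<alpha> e = \<infinity>"
    using threshold_weight_finite[OF E(3) \<alpha>] by auto
  moreover have "max (walk_spike p) (W_spike I e) \<le> max (walk_spike q) (W_spike I e)"
  proof (cases "path_weight I \<alpha> p < path_weight I \<alpha> q")
    case True
    then have "path_weight I \<alpha> p < \<infinity>"
      by auto
    then have "walk_spike p \<le> \<alpha>"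
      using path_weight_finite[OF E(1) \<alpha>] by (simp add: walk_spike_def SUP_le_iff)
    then show ?thesis
      using False by (auto simp: le_max_iff_disj)
  next
    case False
    then show ?thesis
      using pq by (auto simp: no_worse_def le_max_iff_disj)
  qed
  ultimately show ?thesis
    by (simp add: no_worse_def path_weight_snoc walk_spike_snoc)
qed

definition optimal_walk :: "ereal \<Rightarrow> ('x, 'u) edge set \<Rightarrow> 'x vertex \<Rightarrow> ('x, 'u) edge list \<Rightarrow> bool" where
  "optimal_walk \<alpha> D v p \<longleftrightarrow> walk Source p v \<and> set p \<subseteq> D \<and>
     (\<forall>q. walk Source q v \<longrightarrow> set q \<subseteq> D \<longrightarrow> no_worse \<alpha> p q)"

text \<open>The invariant of the program once the edges in \<open>D\<close> have been processed: exactly the vertices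
  reachable through \<open>D\<close> have a label.\<close>

definition labels_optimal ::
    "ereal \<Rightarrow> ('x, 'u) edge set \<Rightarrow> ('x vertex \<Rightarrow> ('x, 'u) label option) \<Rightarrow> bool" where
  "labels_optimal \<alpha> D M \<longleftrightarrow> (\<forall>v. case M v of
       None \<Rightarrow> \<forall>q. walk Source q v \<longrightarrow> \<not> set q \<subseteq> D
     | Some l \<Rightarrow> \<exists>p. optimal_walk \<alpha> D v p \<and> l = walk_label \<alpha> p)"

lemma labels_optimalI:
  assumes "\<And>v q. M v = None \<Longrightarrow> walk Source q v \<Longrightarrow> \<not> set q \<subseteq> D"
    and "\<And>v l. M v = Some l \<Longrightarrow> \<exists>p. optimal_walk \<alpha> D v p \<and> l = walk_label \<alpha> p"
  shows "labels_optimal \<alpha> D M"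
  unfolding labels_optimal_def
proof
  fix v
  show "case M v of None \<Rightarrow> \<forall>q. walk Source q v \<longrightarrow> \<not> set q \<subseteq> D
    | Some l \<Rightarrow> \<exists>p. optimal_walk \<alpha> D v p \<and> l = walk_label \<alpha> p"
    using assms by (cases "M v") auto
qed

lemma labels_optimal_None:
  "labels_optimal \<alpha> D M \<Longrightarrow> M v = None \<Longrightarrow> walk Source q v \<Longrightarrow> \<not> set q \<subseteq> D"
  unfolding labels_optimal_def by (auto dest: spec[of _ v])

lemma labels_optimal_Some:
  assumes "labels_optimal \<alpha> D M" "M v = Some l"
  obtains p where "optimal_walk \<alpha> D v p" "l = walk_label \<alpha> p"
proof -
  have "case M v of None \<Rightarrow> \<forall>q. walk Source q v \<longrightarrow> \<not> set q \<subseteq> D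
    | Some l \<Rightarrow> \<exists>p. optimal_walk \<alpha> D v p \<and> l = walk_label \<alpha> p"
    using assms(1) unfolding labels_optimal_def by blast
  then show thesis
    using assms(2) that by auto
qed

text \<open>In a topological order no edge processed so far leaves the head of the new edge, so
  the new edge can only be the last one of a walk.\<close>

lemma walk_new_edge_last:
  assumes q: "walk u q v" "set q \<subseteq> insert e D" "e \<in> set q"
    and D: "\<forall>d\<in>D. edge_tail I d \<noteq> edge_head I e"
  obtains q' where "q = q' @ [e]" "set q' \<subseteq> D" "walk u q' (edge_tail I e)" "v = edge_head I e"
proof -
  obtain q1 q2 where split: "q = q1 @ e # q2"
    using split_list[OF q(3)] by blast
  have w: "walk u q1 (edge_tail I e)" "e \<in> E" "walk (edge_head I e) q2 v"
    using q(1) by (auto simp: split walk_append)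
  have "q2 = []"
  proof (cases q2)
    case (Cons d q3)
    then have "edge_tail I d = edge_head I e" "d \<in> insert e D"
      using w(3) q(2) by (auto simp: split)
    then show ?thesis
      using D rank_edge[OF w(2)] by auto
  qed
  moreover have "set q1 \<subseteq> D"
    using distinct_walk[OF q(1)] q(2) by (auto simp: split)
  ultimately show thesis
    using that w split by simp
qed

lemma relax_step:
  assumes M: "labels_optimal \<alpha> D M" and E: "D \<subseteq> E" "e \<in> E" and \<alpha>: "\<alpha> < \<infinity>"
    and D: "\<forall>d\<in>D. edge_tail I d \<noteq> edge_head I e"
  shows "labels_optimal \<alpha> (insert e D) (fst (relax I \<alpha> (entry e) M))"
proof -
  let ?M = "fst (relax I \<alpha> (entry e) M)"
  let ?t = "edge_tail I e" and ?h = "edge_head I e"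
  have old: "set q \<subseteq> D" if q: "walk Source q v" "set q \<subseteq> insert e D" "v \<noteq> ?h" for q v
  proof -
    have "e \<notin> set q"
      using walk_new_edge_last[OF q(1,2) _ D] q(3) by blast
    then show ?thesis
      using q(2) by blast
  qed
  have keep: "optimal_walk \<alpha> (insert e D) v p" if "optimal_walk \<alpha> D v p" "v \<noteq> ?h" for v p
    using that old unfolding optimal_walk_def by blast
  show ?thesis
  proof (cases "M ?t")
    case None
    then have M': "?M = M"
      by (simp add: relax_def step_def)
    have old': "set q \<subseteq> D" if q: "walk Source q v" "set q \<subseteq> insert e D" for q v
    proof -
      have "e \<notin> set q"
        using walk_new_edge_last[OF q _ D] labels_optimal_None[OF M None] by blast
      then show ?thesis
        using q(2) by blast
    qed
    show ?thesis
      unfolding M'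
    proof (rule labels_optimalI)
      show "\<not> set q \<subseteq> insert e D" if "M v = None" "walk Source q v" for v q
        using labels_optimal_None[OF M that] old'[OF that(2)] by blast
      show "\<exists>p. optimal_walk \<alpha> (insert e D) v p \<and> l = walk_label \<alpha> p" if l: "M v = Some l" for v l
      proof -
        obtain p where "optimal_walk \<alpha> D v p" "l = walk_label \<alpha> p"
          using M l by (rule labels_optimal_Some)
        then show ?thesis
          using old' unfolding optimal_walk_def by blast
      qed
    qed
  next
    case (Some l)
    obtain p where p: "optimal_walk \<alpha> D ?t p" "l = walk_label \<alpha> p"
      using M Some by (rule labels_optimal_Some)
    let ?p = "p @ [e]"
    have M': "?M = (if better (walk_label \<alpha> ?p) (M ?h) then M(?h \<mapsto> walk_label \<alpha> ?p) else M)"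
      by (simp add: relax_def step_def Some p(2) extend_walk_label)
    have p': "walk Source ?p ?h" "set ?p \<subseteq> insert e D"
      using p(1) E(2) by (auto simp: optimal_walk_def walk_append)
    have new: "no_worse \<alpha> ?p q" if q: "walk Source q ?h" "set q \<subseteq> insert e D" "e \<in> set q" for q
    proof -
      obtain q' where "q = q' @ [e]" "set q' \<subseteq> D" "walk Source q' ?t"
        using q D by (rule walk_new_edge_last)
      then show ?thesis
        using p(1) E \<alpha> unfolding optimal_walk_def by (auto intro!: no_worse_snoc)
    qed
    have at_head: "\<exists>r. optimal_walk \<alpha> (insert e D) ?h r \<and> ?M ?h = Some (walk_label \<alpha> r)"
    proof (cases "M ?h")
      case None
      have "set q \<subseteq> insert e D \<Longrightarrow> e \<in> set q" if "walk Source q ?h" for q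
        using labels_optimal_None[OF M None that] by blast
      then have "optimal_walk \<alpha> (insert e D) ?h ?p"
        using p' new unfolding optimal_walk_def by blast
      then show ?thesis
        by (auto simp: M' None)
    next
      case (Some l')
      obtain r where r: "optimal_walk \<alpha> D ?h r" "l' = walk_label \<alpha> r"
        using M Some by (rule labels_optimal_Some)
      have r_le: "no_worse \<alpha> r q" if "walk Source q ?h" "set q \<subseteq> insert e D" "e \<notin> set q" for q
        using r(1) that unfolding optimal_walk_def by blast
      show ?thesis
      proof (cases "no_worse \<alpha> r ?p")
        case True
        then have "optimal_walk \<alpha> (insert e D) ?h r"
          using r new r_le no_worse_trans unfolding optimal_walk_def by blast
        then show ?thesis
          using True by (auto simp: M' Some r better_iff)
      next
        case False
        then have "optimal_walk \<alpha> (insert e D) ?h ?p"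
          using p' new r_le no_worse_trans[OF no_worse_total[OF False]] unfolding optimal_walk_def by blast
        then show ?thesis
          using False by (auto simp: M' Some r better_iff)
      qed
    qed
    have elsewhere: "?M v = M v" if "v \<noteq> ?h" for v
      using that by (simp add: M')
    show ?thesis
    proof (rule labels_optimalI)
      show "\<not> set q \<subseteq> insert e D" if "?M v = None" "walk Source q v" for v q
      proof (cases "v = ?h")
        case True
        then show ?thesis
          using at_head that(1) by auto
      next
        case False
        then have "M v = None"
          using that(1) elsewhere by simp
        then show ?thesis
          using labels_optimal_None[OF M _ that(2)] old[OF that(2) _ False] by blast
      qed
      show "\<exists>r. optimal_walk \<alpha> (insert e D) v r \<and> l = walk_label \<alpha> r" if "?M v = Some l" for v l
      proof (cases "v = ?h")
        case True
        then show ?thesis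
          using at_head that by auto
      next
        case False
        then have "M v = Some l"
          using that elsewhere by simp
        with M obtain r where "optimal_walk \<alpha> D v r" "l = walk_label \<alpha> r"
          by (rule labels_optimal_Some)
        then show ?thesis
          using keep False by blast
      qed
    qed
  qed
qed

lemma relax_all:
  assumes "labels_optimal \<alpha> D M" "D \<subseteq> E" "set es \<subseteq> E" "\<alpha> < \<infinity>"
    and "\<forall>e\<in>set es. \<forall>d\<in>D. edge_head I e \<noteq> edge_tail I d"
    and "sorted_wrt (\<lambda>e e'. edge_head I e' \<noteq> edge_tail I e) es"
  shows "labels_optimal \<alpha> (D \<union> set es) (fst (loop (relax I \<alpha>) (map entry es) M))"
  using assms
proof (induction es arbitrary: D M)
  case (Cons e es)
  have "labels_optimal \<alpha> (insert e D) (fst (relax I \<alpha> (entry e) M))"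
    using Cons.prems by (intro relax_step) force+
  then have "labels_optimal \<alpha> (insert e D \<union> set es)
      (fst (loop (relax I \<alpha>) (map entry es) (fst (relax I \<alpha> (entry e) M))))"
    using Cons.prems by (intro Cons.IH) auto
  then show ?case
    by simp
qed simp

lemma labels_optimal_initial: "labels_optimal \<alpha> {} [Source \<mapsto> (0, 0, -\<infinity>, [])]"
proof -
  have "walk_label \<alpha> [] = (0, 0, -\<infinity>, [])"
    by (simp add: walk_label_def path_weight_def walk_spike_def bot_ereal_def)
  moreover have "optimal_walk \<alpha> {} Source []"
    by (auto simp: optimal_walk_def no_worse_refl)
  ultimately show ?thesis
    unfolding labels_optimal_def by auto
qed

lemma shortest_path_prog_correct:
  assumes wp: "well_posed I" and es: "edge_list I es" and \<alpha>: "\<alpha> < \<infinity>"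
  obtains p where "shortest_path I \<alpha> p"
    "fst (shortest_path_prog I (map entry es) \<alpha>) = (path_value I p, rev p)"
proof -
  let ?M = "fst (loop (relax I \<alpha>) (map entry es) [Source \<mapsto> (0, 0, -\<infinity>, [])])"
  have set_es: "set es = E"
    using es by (simp add: edge_list_def)
  have "labels_optimal \<alpha> ({} \<union> set es) ?M"
    using es \<alpha> by (intro relax_all labels_optimal_initial) (auto simp: edge_list_def)
  then have M: "labels_optimal \<alpha> E ?M"
    by (simp add: set_es)
  obtain q where "walk Source q Terminal"
    using wp by (auto simp: well_posed_def st_paths_iff)
  then obtain l where l: "?M Terminal = Some l"
    using labels_optimal_None[OF M, of Terminal q] walk_edges by (cases "?M Terminal") auto
  obtain p where p: "optimal_walk \<alpha> E Terminal p" "l = walk_label \<alpha> p"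
    using M l by (rule labels_optimal_Some)
  then have "p \<in> st_paths I"
    by (simp add: optimal_walk_def st_paths_iff)
  moreover have "no_worse \<alpha> p q" if "q \<in> st_paths I" for q
    using p(1) that walk_edges by (auto simp: optimal_walk_def st_paths_iff)
  ultimately have "shortest_path I \<alpha> p"
    by (simp add: shortest_path_def no_worse_def path_spike_eq[OF wp])
  moreover have "fst (shortest_path_prog I (map entry es) \<alpha>) = (path_value I p, rev p)"
    using l p(2) path_spike_eq[OF wp \<open>p \<in> st_paths I\<close>]
    by (simp add: shortest_path_prog_def walk_label_def path_value_def)
  ultimately show thesis
    by (rule that)
qed

section \<open>Correctness and running time of the implementation\<close>

lemma fst_edge_cost_prog: "fst (edge_cost_prog I e \<xi>) = edge_cost I e \<xi>"
  by (cases e) (simp_all add: fst_sum_loop interv_sum_list_conv_sum_set_nat)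

lemma snd_edge_cost_prog: "snd (edge_cost_prog I (Trans t x u) \<xi>) \<le> 2 * dur I x u + 1"
  using snd_loop[of "[t..<t + dur I x u]" "\<lambda>t acc. step (acc + stage_cost I x u \<xi> t)" 1] by (simp add: mult_2)

lemma weights_prog_correct:
  assumes "e \<in> E"
  shows "fst (weights_prog I e) = (W_bias I e, W_spike I e)"
  using assms
proof (cases rule: edge_cases)
  case (trans t x u)
  let ?f = "\<lambda>k. max (edge_cost I e (spike_P I k)) (edge_cost I e (spike_H I k))"
  have "Max (?f ` {t..<t + dur I x u}) = (SUP k\<in>{t..<t + dur I x u}. ?f k)"
    using trans by (intro Max_Sup) auto
  then show ?thesis
    by (simp add: trans(1) fst_edge_cost_prog W_bias_def fst_max_loop[where f = ?f]
        del: edge_cost.simps edge_cost_prog.simps)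
qed (simp_all add: W_bias_def)

lemma snd_weights_prog: "snd (weights_prog I (Trans t x u)) \<le> weights_steps (dur I x u)"
proof -
  let ?e = "Trans t x u" and ?c = "dur I x u"
  let ?body = "\<lambda>k acc. bind_timed (edge_cost_prog I ?e (spike_P I k)) (\<lambda>cp.
    bind_timed (edge_cost_prog I ?e (spike_H I k)) (\<lambda>ch. step (max acc (max cp ch))))"
  have "snd (?body k acc) \<le> 4 * ?c + 3" for k acc
    using snd_edge_cost_prog[of t x u "spike_P I k"] snd_edge_cost_prog[of t x u "spike_H I k"]
    by (simp del: edge_cost_prog.simps)
  then have "snd (loop ?body [t..<t + ?c] (-\<infinity>)) \<le> ?c * (4 * ?c + 4) + 1"
    using snd_loop[of "[t..<t + ?c]" ?body "4 * ?c + 3" "-\<infinity>"]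
    by (simp add: algebra_simps del: edge_cost_prog.simps)
  moreover have "snd (edge_cost_prog I ?e (bias_demand I)) \<le> 2 * ?c + 1"
    by (rule snd_edge_cost_prog)
  ultimately show ?thesis
    by (simp add: weights_steps_def del: edge_cost_prog.simps)
qed

lemma dur_le_max_dur:
  assumes "Trans t x u \<in> transitions I"
  shows "dur I x u \<le> max_dur I"
proof -
  have "{dur I x u | t x u. Trans t x u \<in> transitions I} \<subseteq>
      (\<lambda>e. case e of Trans t x u \<Rightarrow> dur I x u | _ \<Rightarrow> 0) ` transitions I"
    by force
  then have "finite {dur I x u | t x u. Trans t x u \<in> transitions I}"
    using finite_transitions by (meson finite_imageI finite_subset)
  then show ?thesis
    unfolding max_dur_def using assms by (intro Max_ge) auto
qed

lemma weights_prog_steps: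
  assumes "e \<in> E"
  shows "snd (weights_prog I e) \<le> weights_steps (max_dur I)"
  using assms
proof (cases rule: edge_cases)
  case (trans t x u)
  have "snd (weights_prog I e) \<le> weights_steps (dur I x u)"
    unfolding trans(1) by (rule snd_weights_prog)
  also have "\<dots> \<le> weights_steps (max_dur I)"
    unfolding weights_steps_def using dur_le_max_dur[of t x u] trans
    by (intro add_mono mult_mono order_refl) auto
  finally show ?thesis .
qed (simp_all add: weights_steps_def)

definition spikes_of :: "('x, 'u) edge set \<Rightarrow> ereal set" where
  "spikes_of A = {W_spike I e | e. e \<in> A \<and> is_Trans e \<and> W_spike I e < \<infinity>}"

lemma spikes_of_insert: "spikes_of (insert e A) =
    (if is_Trans e \<and> W_spike I e < \<infinity> then insert (W_spike I e) (spikes_of A) else spikes_of A)"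
  by (auto simp: spikes_of_def)

lemma range_loop:
  "fst (loop (\<lambda>(e, b, s) (lo, hi).
      step (if is_Trans e \<and> s < \<infinity> then (min lo s, max hi s) else (lo, hi))) (map entry es) (lo, hi)) =
    (min lo (Inf (spikes_of (set es))), max hi (Sup (spikes_of (set es))))"
proof (induction es arbitrary: lo hi)
  case Nil
  then show ?case
    by (simp add: spikes_of_def bot_ereal_def top_ereal_def)
next
  case (Cons e es)
  then show ?case
    by (simp add: entry_def spikes_of_insert min.assoc max.assoc inf_min sup_max)
qed

lemma range_prog_correct:
  assumes wp: "well_posed I" and es: "set es = E"
  shows "fst (range_prog (map entry es)) = (W_min I, W_max I)"
proof -
  have "spikes_of E = finite_spikes I"
    by (auto simp: spikes_of_def finite_spikes_def transitions_iff)
  moreover have "W_min I = Inf (finite_spikes I)" "W_max I = Sup (finite_spikes I)"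
    using wp finite_spikes_Min_Max(1)[OF wp]
    by (simp_all add: W_min_def W_max_def well_posed_def Min_Inf Max_Sup)
  ultimately show ?thesis
    unfolding range_prog_def range_loop es by simp
qed

lemma snd_range_prog: "snd (range_prog tbl) \<le> 2 * length tbl + 1"
  unfolding range_prog_def
  using snd_loop[of tbl "\<lambda>(e, b, s) (lo, hi).
      step (if is_Trans e \<and> s < \<infinity> then (min lo s, max hi s) else (lo, hi))" 1 "(\<infinity>, -\<infinity>)"]
  by (simp add: case_prod_unfold)

lemma snd_shortest_path_prog: "snd (shortest_path_prog I tbl \<alpha>) \<le> 2 * length tbl + 2"
  using snd_loop[of tbl "relax I \<alpha>" 1 "[Source \<mapsto> (0, 0, -\<infinity>, [])]"]
  by (simp add: shortest_path_prog_def relax_def)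

text \<open>The largest threshold is solved separately, and there are
  \<open>\<lceil>(W_max - W_min) / \<epsilon>\<rceil>\<close> smaller ones.  If the quotient is an integer, the grid point with this index
  is the largest threshold itself, so the strict inequality for \<open>k\<close> loses nothing.\<close>

lemma Thresh_eq:
  assumes wp: "well_posed I" and \<epsilon>: "0 < \<epsilon>"
  shows "Thresh I \<epsilon> = insert (W_max I) ((\<lambda>k. W_min I + ereal (real k * \<epsilon>)) `
    {..<nat \<lceil>real_of_ereal (W_max I - W_min I) / \<epsilon>\<rceil>})"
proof -
  obtain m M where mM: "W_min I = ereal m" "W_max I = ereal M"
    using wp by (rule W_min_W_max_real)
  have "k < nat \<lceil>(M - m) / \<epsilon>\<rceil> \<longleftrightarrow> m + real k * \<epsilon> < M" for k
  proof -
    have "k < nat \<lceil>(M - m) / \<epsilon>\<rceil> \<longleftrightarrow> int k < \<lceil>(M - m) / \<epsilon>\<rceil>"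
      by linarith
    also have "\<dots> \<longleftrightarrow> real k < (M - m) / \<epsilon>"
      by (simp add: less_ceiling_iff)
    finally show ?thesis
      using \<epsilon> by (simp add: field_simps)
  qed
  then show ?thesis
    by (auto simp: Thresh_def mM order_le_less image_iff)
qed

text \<open>Each of at most \<open>rounds I \<epsilon> + 1\<close> shortest-path problems takes two steps per edge and
  two more.  The table, the range and the reversal of the path take at most \<open>B + 6\<close> steps
  per edge.  All remaining steps are constant in number or once per round, and they are absorbed
  because there is at least one edge and one round.\<close>

lemma algorithm_prog_correct:
  assumes wp: "well_posed I" and \<epsilon>: "0 < \<epsilon>" and es: "edge_list I es"
    and weights: "\<And>e. e \<in> E \<Longrightarrow> fst (weights e) = (W_bias I e, W_spike I e)"
      "\<And>e. e \<in> E \<Longrightarrow> snd (weights e) \<le> B"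
  shows "case algorithm_prog I weights es \<epsilon> of ((v, p), steps) \<Rightarrow>
    algorithm_A I (Thresh I \<epsilon>) v p \<and> steps \<le> (B + 22) * card E * rounds I \<epsilon>"
proof -
  have set_es: "set es = E" and len: "length es = card E"
    using es distinct_card[of es] by (simp_all add: edge_list_def)
  let ?tbl = "map entry es"
  let ?SP = "shortest_path_prog I ?tbl"
  let ?n = "nat \<lceil>real_of_ereal (W_max I - W_min I) / \<epsilon>\<rceil>"
  let ?th = "\<lambda>k. W_min I + ereal (real k * \<epsilon>)"
  let ?table_prog = "map_timed (\<lambda>e. bind_timed (weights e) (\<lambda>(b, s). step (e, b, s))) es"
  let ?search = "loop (\<lambda>k best. bind_timed (?SP (?th k))
    (\<lambda>cand. step (if fst cand < fst best then cand else best))) [0..<?n] (fst (?SP (W_max I)))"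
  let ?v = "fst (fst ?search)" and ?p = "snd (fst ?search)"
  let ?reverse = "loop (\<lambda>e acc. step (e # acc)) ?p []"
  have tbl: "fst ?table_prog = ?tbl"
    using weights(1) set_es by (simp add: fst_map_timed entry_def case_prod_unfold)
  have prog: "algorithm_prog I weights es \<epsilon> = ((?v, rev ?p),
      snd ?table_prog + snd (range_prog ?tbl) + 1 + snd (?SP (W_max I)) + snd ?search + snd ?reverse + 1)"
    using tbl range_prog_correct[OF wp set_es]
    by (simp add: algorithm_prog_def prod_eq_iff case_prod_unfold reverse_loop)
  define V where "V \<alpha> = rev (snd (fst (?SP \<alpha>)))" for \<alpha>
  have V: "shortest_path I \<alpha> (V \<alpha>)" "fst (?SP \<alpha>) = (path_value I (V \<alpha>), rev (V \<alpha>))"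
    if "\<alpha> \<in> Thresh I \<epsilon>" for \<alpha>
    using shortest_path_prog_correct[OF wp es Thresh_finite_value[OF wp that]]
    by (metis V_def rev_rev_ident snd_conv)+
  have Thresh: "Thresh I \<epsilon> = insert (W_max I) (?th ` set [0..<?n])"
    unfolding Thresh_eq[OF wp \<epsilon>] by (simp add: lessThan_atLeast0)
  have "fst ?search \<in> (\<lambda>\<alpha>. fst (?SP \<alpha>)) ` Thresh I \<epsilon>"
    and best: "\<forall>r\<in>(\<lambda>\<alpha>. fst (?SP \<alpha>)) ` Thresh I \<epsilon>. ?v \<le> fst r"
    using best_loop[of "\<lambda>k. ?SP (?th k)" "[0..<?n]" "fst (?SP (W_max I))"]
    unfolding Thresh image_insert image_image by blast+
  then obtain \<gamma> where \<gamma>: "\<gamma> \<in> Thresh I \<epsilon>" "fst ?search = fst (?SP \<gamma>)"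
    by blast
  then have v: "?v = path_value I (V \<gamma>)" and p: "rev ?p = V \<gamma>"
    using V(2)[OF \<gamma>(1)] by simp_all
  have le: "?v \<le> path_value I (V \<beta>)" if "\<beta> \<in> Thresh I \<epsilon>" for \<beta>
    using bspec[OF best imageI[OF that]] V(2)[OF that] by simp
  have correct: "algorithm_A I (Thresh I \<epsilon>) ?v (rev ?p)"
    unfolding algorithm_A_def
    by (intro exI[of _ V] conjI ballI bexI[of _ \<gamma>] V(1) \<gamma>(1) v p le[unfolded v])
  have "walk Source (V \<gamma>) Terminal"
    using V(1)[OF \<gamma>(1)] by (simp add: shortest_path_def st_paths_iff)
  then have len_p: "length ?p \<le> card E"
    unfolding p[symmetric] using length_walk[of Source "V \<gamma>" Terminal] p[symmetric] by simp
  obtain q where "q \<in> st_paths I"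
    using wp by (auto simp: well_posed_def)
  then obtain e where "e \<in> set q" "set q \<subseteq> E"
    using path_has_transition[OF wp, of q] walk_edges[of Source q Terminal]
    by (auto simp: st_paths_iff)
  then have "E \<noteq> {}"
    by blast
  then have E1: "1 \<le> card E"
    using finite_E by (simp add: Suc_leI card_gt_0_iff)
  have R: "1 \<le> rounds I \<epsilon>" "?n \<le> rounds I \<epsilon>"
    by (simp_all add: rounds_def)
  have SP: "snd (?SP \<alpha>) \<le> 2 * card E + 2" for \<alpha>
    using snd_shortest_path_prog[of ?tbl \<alpha>] len by simp
  have "snd ?table_prog \<le> card E * (B + 2) + 1"
    using snd_map_timed[of es "\<lambda>e. bind_timed (weights e) (\<lambda>(b, s). step (e, b, s))" "B + 1"]
      weights(2) set_es len by (simp add: case_prod_unfold)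
  moreover have "snd (range_prog ?tbl) \<le> 2 * card E + 1"
    using snd_range_prog[of ?tbl] len by simp
  moreover have "snd (?SP (W_max I)) \<le> 2 * card E + 2"
    by (rule SP)
  moreover have "snd ?search \<le> ?n * (2 * card E + 4) + 1"
    using snd_loop[of "[0..<?n]" "\<lambda>k best. bind_timed (?SP (?th k))
      (\<lambda>cand. step (if fst cand < fst best then cand else best))" "2 * card E + 3"] SP
    by (simp add: add.commute)
  moreover have "snd ?reverse \<le> 2 * card E + 1"
    using snd_loop[of ?p "\<lambda>e acc. step (e # acc)" 1 "[]"] len_p by simp
  ultimately have "snd ?table_prog + snd (range_prog ?tbl) + 1 + snd (?SP (W_max I)) + snd ?search +
      snd ?reverse + 1 \<le> (card E * (B + 2) + 1) + (2 * card E + 1) + 1 + (2 * card E + 2) +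
        (?n * (2 * card E + 4) + 1) + (2 * card E + 1) + 1"
    by (intro add_mono order_refl)
  also have "\<dots> = card E * (B + 8) + ?n * (2 * card E + 4) + 8"
    by (simp add: distrib_left)
  also have "\<dots> \<le> card E * (B + 8) + rounds I \<epsilon> * (2 * card E + 4 * card E) + 8 * card E"
    using R(2) E1 by (intro add_mono mult_mono) auto
  also have "\<dots> = card E * (B + 16) + 6 * card E * rounds I \<epsilon>"
    by (simp add: algebra_simps)
  also have "\<dots> \<le> card E * (B + 16) * rounds I \<epsilon> + 6 * card E * rounds I \<epsilon>"
    using R(1) by (intro add_mono order_refl) simp
  also have "\<dots> = (B + 22) * card E * rounds I \<epsilon>"
    by (simp add: algebra_simps)
  finally show ?thesis
    using correct unfolding prog by simp
qed

end

theorem theorem3: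
  "\<exists>(K :: nat) (K' :: nat \<Rightarrow> nat). \<forall>(I :: ('x, 'u) mgt) (\<epsilon> :: real).
     mgt_model I \<longrightarrow> well_posed I \<longrightarrow> no_hidden_infinity I \<longrightarrow> 0 < \<epsilon> \<longrightarrow>
       (\<exists>v p. algorithm_A I (Thresh I \<epsilon>) v p) \<and>
       (\<forall>v p. algorithm_A I (Thresh I \<epsilon>) v p \<longrightarrow> V_star I \<le> v \<and> v \<le> V_star I + ereal \<epsilon>) \<and>
       (\<forall>es. edge_list I es \<longrightarrow>
          (case algorithm_prog I (weights_oracle I) es \<epsilon> of ((v, p), steps) \<Rightarrow>
             algorithm_A I (Thresh I \<epsilon>) v p \<and> steps \<le> K * card (arcs (mgt_graph I)) * rounds I \<epsilon>) \<and>
          (case algorithm_prog I (weights_prog I) es \<epsilon> of ((v, p), steps) \<Rightarrow>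
             algorithm_A I (Thresh I \<epsilon>) v p \<and> steps \<le> K' (max_dur I) * card (arcs (mgt_graph I)) * rounds I \<epsilon>))"
  \<comment> \<open>The steps per edge for delivering its weights, plus \<open>22\<close> for the rest: one step if they are
    given, and \<open>weights_steps\<close> of the largest duration if they are evaluated.\<close>
proof (rule exI[of _ "1 + 22"], rule exI[of _ "\<lambda>d. weights_steps d + 22"], intro allI impI)
  fix I :: "('x, 'u) mgt" and \<epsilon> :: real
  assume "mgt_model I" and wp: "well_posed I" and nhi: "no_hidden_infinity I" and \<epsilon>: "0 < \<epsilon>"
  then interpret turbine I
    by unfold_locales
  have given_weights: "case algorithm_prog I (weights_oracle I) es \<epsilon> of ((v, p), steps) \<Rightarrow>
      algorithm_A I (Thresh I \<epsilon>) v p \<and> steps \<le> (1 + 22) * card (arcs (mgt_graph I)) * rounds I \<epsilon>"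
    if "edge_list I es" for es
    using wp \<epsilon> that by (rule algorithm_prog_correct) (simp_all add: weights_oracle_def)
  have direct_evaluation: "case algorithm_prog I (weights_prog I) es \<epsilon> of ((v, p), steps) \<Rightarrow>
      algorithm_A I (Thresh I \<epsilon>) v p \<and>
      steps \<le> (weights_steps (max_dur I) + 22) * card (arcs (mgt_graph I)) * rounds I \<epsilon>"
    if "edge_list I es" for es
    using wp \<epsilon> that by (rule algorithm_prog_correct) (rule weights_prog_correct weights_prog_steps, assumption)+
  show "(\<exists>v p. algorithm_A I (Thresh I \<epsilon>) v p) \<and>
      (\<forall>v p. algorithm_A I (Thresh I \<epsilon>) v p \<longrightarrow> V_star I \<le> v \<and> v \<le> V_star I + ereal \<epsilon>) \<and>
      (\<forall>es. edge_list I es \<longrightarrow>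
        (case algorithm_prog I (weights_oracle I) es \<epsilon> of ((v, p), steps) \<Rightarrow>
           algorithm_A I (Thresh I \<epsilon>) v p \<and>
           steps \<le> (1 + 22) * card (arcs (mgt_graph I)) * rounds I \<epsilon>) \<and>
        (case algorithm_prog I (weights_prog I) es \<epsilon> of ((v, p), steps) \<Rightarrow>
           algorithm_A I (Thresh I \<epsilon>) v p \<and>
           steps \<le> (weights_steps (max_dur I) + 22) * card (arcs (mgt_graph I)) * rounds I \<epsilon>))"
    by (intro conjI allI impI algorithm_A_exists[OF wp \<epsilon>] algorithm_A_bounds[OF wp nhi \<epsilon>]
        given_weights direct_evaluation)
qed

end
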